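(* Let $a<b$, let $p_1,p_2,q$ be integers, and suppose $r=\min\{p_1,p_2,q\}>1$. Let $k(t,s)$ be a $(p_1,p_2)$-semismooth kernel on $[a,b]\times[a,b]$ with associated $k_1\in C^{p_1}([a,b]\times[a,b])$ and $k_2\in C^{p_2}([a,b]\times[a,b])$, and let $y\in C^{q}([a,b])$. Suppose that the equation $$x(t)+\int_a^t k_1(t,s)x(s)\,ds+\int_t^b k_2(t,s)x(s)\,ds=y(t),\qquad a\le t\le b,$$ defines an invertible operator on $C^{r}([a,b])$ (i.e. the operator taking $x$ to the left-hand side is invertible on $C^r([a,b])$), and let $x$ be its solution. For each $n$, let $\hat{\mathbf x}=(x(\eta_0),\dots,x(\eta_n))^T$ and $\bar{\mathbf y}=(y(\eta_0),\dots,y(\eta_n))^T$, and let $\bar{\mathbf x}\in\mathbb R^{n+1}$ be a solution vector of the linear system $$\Bigl[\mathbf I+\tfrac{b-a}{2}\bigl(\mathbf W\circ\mathbf K_1+\mathbf V\circ\mathbf K_2\bigr)\Bigr]\bar{\mathbf x}=\bar{\mathbf y}.$$ Then, as $n\to\infty$, $$\Bigl\|\Bigl(\mathbf I+\tfrac{b-a}{2}\bigl(\mathbf W\circ\mathbf K_1+\mathbf V\circ\mathbf K_2\bigr)\Bigr)(\hat{\mathbf x}-\bar{\mathbf x})\Bigr\|_\infty=O\!\left(\frac1{n^{r-1}}\right).$$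
   Context: Semismooth kernel: $k(t,s)$ is called $(p_1,p_2)$-semismooth (with $p_1,p_2>1$) if $k(t,s)=k_1(t,s)$ for $a\le s\le t$ and $k(t,s)=k_2(t,s)$ for $t\le s\le b$, where $k_1\in C^{p_1}$ and $k_2\in C^{p_2}$ are both defined on the whole square $[a,b]\times[a,b]$. Discretization, for given $n$ (all matrices below are $(n+1)\times(n+1)$ with rows and columns indexed $0,\dots,n$, and depend on $n$): $T_j(s)=\cos(j\arccos s)$ are the Chebyshev polynomials; $\tau_k=\cos\frac{(2k+1)\pi}{2(n+1)}$, $k=0,\dots,n$, are the zeros of $T_{n+1}$; $\eta_k=\frac{b-a}{2}\tau_k+\frac{a+b}{2}$. $\mathbf C$ is the matrix with entries $\mathbf C_{kj}=T_j(\tau_k)$. Let $\mathbf B$ be the matrix whose row $0$ is zero, whose row $1$ has entries $\mathbf B_{1,0}=1$, $\mathbf B_{1,2}=-\frac12$, whose row $j$ for $2\le j\le n$ has entries $\mathbf B_{j,j-1}=\frac1{2j}$ and (if $j+1\le n$) $\mathbf B_{j,j+1}=-\frac1{2j}$, and all other entries zero. The left spectral integration matrix is $\mathbf S_L=\mathbf P_L\mathbf B$, where $\mathbf P_L$ has row $0$ equal to $(1,1,-1,1,\dots,(-1)^{n+1})$ (entry $(-1)^{j+1}$ in column $j\ge1$) and its rows $1,\dots,n$ are those of the identity matrix. The right spectral integration matrix is $\mathbf S_R=\mathbf P_R\mathbf B$, where $\mathbf P_R$ has row $0$ equal to $(1,1,\dots,1)$ and its rows $1,\dots,n$ are those of minus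 the identity matrix. Set $\mathbf W=\mathbf C\mathbf S_L\mathbf C^{-1}$, $\mathbf V=\mathbf C\mathbf S_R\mathbf C^{-1}$, $\mathbf K_1=(k_1(\eta_i,\eta_j))_{i,j=0}^n$, $\mathbf K_2=(k_2(\eta_i,\eta_j))_{i,j=0}^n$. The symbol $\circ$ denotes the Schur (entrywise) product, $\mathbf I$ the identity matrix, and $\|\cdot\|_\infty$ the maximum norm on $\mathbb R^{n+1}$. The constant implied in $O(\cdot)$ is independent of $n$. *)

theory Defs
  imports
    "HOL-Analysis.Analysis"
    "HOL-Library.Landau_Symbols"
    "Jordan_Normal_Form.Gauss_Jordan_Elimination"
begin

unbundle no vec_syntax

section \<open>Functions of class \<open>C\<^sup>k\<close> and the integral operator\<close>

text \<open>
  On a set \<open>S\<close> that is not open, derivatives are taken relative to \<open>S\<close>, so that they are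
  one-sided at the end points of \<open>[a, b]\<close> and on the boundary of the square. On such sets
  the derivative is unique, and the definition below says that all iterated directional
  (hence all partial) derivatives up to order \<open>k\<close> exist and are continuous on \<open>S\<close>.
\<close>

primrec Ck_on ::
  "nat \<Rightarrow> 'a::real_normed_vector set \<Rightarrow> ('a \<Rightarrow> 'b::real_normed_vector) \<Rightarrow> bool"
where
  "Ck_on 0 S f \<longleftrightarrow> continuous_on S f"
| "Ck_on (Suc k) S f \<longleftrightarrow>
     (\<exists>f'. (\<forall>x\<in>S. (f has_derivative f' x) (at x within S)) \<and>
           (\<forall>v. Ck_on k S (\<lambda>x. f' x v)))"

definition semismooth ::
  "real \<Rightarrow> real \<Rightarrow> nat \<Rightarrow> nat \<Rightarrow> (real \<Rightarrow> real \<Rightarrow> real) \<Rightarrow>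
     (real \<Rightarrow> real \<Rightarrow> real) \<Rightarrow> (real \<Rightarrow> real \<Rightarrow> real) \<Rightarrow> bool"
where
  "semismooth a b p1 p2 k k1 k2 \<longleftrightarrow>
     p1 > 1 \<and> p2 > 1 \<and>
     Ck_on p1 ({a..b} \<times> {a..b}) (\<lambda>(t, s). k1 t s) \<and>
     Ck_on p2 ({a..b} \<times> {a..b}) (\<lambda>(t, s). k2 t s) \<and>
     (\<forall>t\<in>{a..b}. \<forall>s\<in>{a..t}. k t s = k1 t s) \<and>
     (\<forall>t\<in>{a..b}. \<forall>s\<in>{t..b}. k t s = k2 t s)"

definition int_op ::
  "real \<Rightarrow> real \<Rightarrow> (real \<Rightarrow> real \<Rightarrow> real) \<Rightarrow> (real \<Rightarrow> real \<Rightarrow> real) \<Rightarrow>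
     (real \<Rightarrow> real) \<Rightarrow> real \<Rightarrow> real"
where
  "int_op a b k1 k2 x t =
     x t + integral {a..t} (\<lambda>s. k1 t s * x s) + integral {t..b} (\<lambda>s. k2 t s * x s)"

text \<open>
  The elements of \<open>C\<^sup>r([a, b])\<close> are represented by extensional functions, so that equality
  of elements is equality on \<open>[a, b]\<close>. Invertibility is bijectivity; the inverse
  is then automatically bounded by the open mapping theorem.
\<close>

definition Cr_space :: "nat \<Rightarrow> real \<Rightarrow> real \<Rightarrow> (real \<Rightarrow> real) set" where
  "Cr_space r a b = {f \<in> extensional {a..b}. Ck_on r {a..b} f}"

definition int_op_invertible ::
  "nat \<Rightarrow> real \<Rightarrow> real \<Rightarrow> (real \<Rightarrow> real \<Rightarrow> real) \<Rightarrow> (real \<Rightarrow> real \<Rightarrow> real) \<Rightarrow> bool"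
where
  "int_op_invertible r a b k1 k2 \<longleftrightarrow>
     bij_betw (\<lambda>x. restrict (int_op a b k1 k2 x) {a..b}) (Cr_space r a b) (Cr_space r a b)"

section \<open>Chebyshev discretization\<close>

definition cheb_T :: "nat \<Rightarrow> real \<Rightarrow> real" where
  "cheb_T j s = cos (real j * arccos s)"

definition tau :: "nat \<Rightarrow> nat \<Rightarrow> real" where
  "tau n k = cos ((2 * real k + 1) * pi / (2 * (real n + 1)))"

definition eta :: "real \<Rightarrow> real \<Rightarrow> nat \<Rightarrow> nat \<Rightarrow> real" where
  "eta a b n k = (b - a) / 2 * tau n k + (a + b) / 2"

definition C_mat :: "nat \<Rightarrow> real mat" where
  "C_mat n = mat (n + 1) (n + 1) (\<lambda>(k, j). cheb_T j (tau n k))"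

definition B_mat :: "nat \<Rightarrow> real mat" where
  "B_mat n = mat (n + 1) (n + 1) (\<lambda>(i, j).
     if i = 0 then 0
     else if i = 1 then (if j = 0 then 1 else if j = 2 then - 1 / 2 else 0)
     else if j = i - 1 then 1 / (2 * real i)
     else if j = i + 1 then - 1 / (2 * real i)
     else 0)"

definition PL_mat :: "nat \<Rightarrow> real mat" where
  "PL_mat n = mat (n + 1) (n + 1) (\<lambda>(i, j).
     if i = 0 then (if j = 0 then 1 else (- 1) ^ (j + 1))
     else if i = j then 1 else 0)"

definition PR_mat :: "nat \<Rightarrow> real mat" where
  "PR_mat n = mat (n + 1) (n + 1) (\<lambda>(i, j).
     if i = 0 then 1 else if i = j then - 1 else 0)"

definition SL_mat :: "nat \<Rightarrow> real mat" where
  "SL_mat n = PL_mat n * B_mat n"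

definition SR_mat :: "nat \<Rightarrow> real mat" where
  "SR_mat n = PR_mat n * B_mat n"

definition C_inv :: "nat \<Rightarrow> real mat" where
  "C_inv n = the (mat_inverse (C_mat n))"

definition W_mat :: "nat \<Rightarrow> real mat" where
  "W_mat n = C_mat n * SL_mat n * C_inv n"

definition V_mat :: "nat \<Rightarrow> real mat" where
  "V_mat n = C_mat n * SR_mat n * C_inv n"

definition K_mat :: "real \<Rightarrow> real \<Rightarrow> (real \<Rightarrow> real \<Rightarrow> real) \<Rightarrow> nat \<Rightarrow> real mat" where
  "K_mat a b \<kappa> n = mat (n + 1) (n + 1) (\<lambda>(i, j). \<kappa> (eta a b n i) (eta a b n j))"

definition schur_prod :: "real mat \<Rightarrow> real mat \<Rightarrow> real mat" (infixl \<open>\<circ>\<^sub>m\<close> 70) where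
  "A \<circ>\<^sub>m B = mat (dim_row A) (dim_col A) (\<lambda>(i, j). A $$ (i, j) * B $$ (i, j))"

definition sys_mat ::
  "real \<Rightarrow> real \<Rightarrow> (real \<Rightarrow> real \<Rightarrow> real) \<Rightarrow> (real \<Rightarrow> real \<Rightarrow> real) \<Rightarrow> nat \<Rightarrow> real mat"
where
  "sys_mat a b k1 k2 n =
     1\<^sub>m (n + 1) +
     ((b - a) / 2) \<cdot>\<^sub>m (W_mat n \<circ>\<^sub>m K_mat a b k1 n + V_mat n \<circ>\<^sub>m K_mat a b k2 n)"

definition sample_vec :: "real \<Rightarrow> real \<Rightarrow> (real \<Rightarrow> real) \<Rightarrow> nat \<Rightarrow> real vec" where
  "sample_vec a b f n = vec (n + 1) (\<lambda>i. f (eta a b n i))"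

definition max_norm :: "real vec \<Rightarrow> real" where
  "max_norm v = Max ((\<lambda>i. \<bar>v $ i\<bar>) ` {..<dim_vec v})"

end

theory Submission
  imports Defs "Jordan_Normal_Form.Determinant"
begin

text \<open>
  Since \<open>sys_mat\<close> applied to \<open>xbar\<close> is the sampled right-hand side, the residual at a node is the
  error of spectral integration applied to \<open>\<sigma> \<mapsto> k\<^sub>i(t, \<sigma>) x(\<sigma>)\<close>, a family of \<open>C\<^sup>r\<close> functions with
  derivatives bounded uniformly in \<open>t\<close>. The recurrence
  \<open>a\<^sub>k(f) = (a\<^bsub>k-1\<^esub>(f') - a\<^bsub>k+1\<^esub>(f')) / (2k)\<close>, applied \<open>r\<close> times, gives Chebyshev coefficients of size
  \<open>O(k\<^sup>-\<^sup>r)\<close>, so the Chebyshev series converges uniformly. Spectral integration is exact on \<open>T\<^sub>k\<close> for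
  \<open>k < n\<close>; for \<open>k \<ge> n\<close> its error on \<open>T\<^sub>k\<close> is bounded by an absolute constant, because on the grid
  \<open>T\<^sub>k\<close> coincides with \<open>0\<close> or \<open>\<plusminus>T\<^sub>m\<close> for some \<open>m \<le> n\<close>. The error is thus bounded by a multiple
  of the tail \<open>\<Sum>\<^bsub>k\<ge>n\<^esub> k\<^sup>-\<^sup>r = O(n\<^sup>1\<^sup>-\<^sup>r)\<close>.
\<close>

section \<open>Cosine coefficients\<close>

lemma
  fixes g :: "nat \<Rightarrow> real \<Rightarrow> real"
  assumes cont: "\<And>i. continuous_on {a..b} (g i)"
    and bound: "\<And>i x. x \<in> {a..b} \<Longrightarrow> \<bar>g i x\<bar> \<le> M i"
    and M: "summable M"
  shows continuous_on_suminf: "continuous_on {a..b} (\<lambda>x. \<Sum>i. g i x)"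
    and sums_integral_suminf:
      "(\<lambda>i. integral {a..b} (g i)) sums integral {a..b} (\<lambda>x. \<Sum>i. g i x)"
proof -
  have ul: "uniform_limit {a..b} (\<lambda>n x. \<Sum>i<n. g i x) (\<lambda>x. \<Sum>i. g i x) sequentially"
    by (rule Weierstrass_m_test[OF _ M]) (use bound in auto)
  have cs: "continuous_on {a..b} (\<lambda>x. \<Sum>i<n. g i x)" for n
    by (intro continuous_on_sum cont)
  show "continuous_on {a..b} (\<lambda>x. \<Sum>i. g i x)"
    by (rule uniform_limit_theorem[OF _ ul]) (use cs in auto)
  obtain I J where I: "\<And>n. ((\<lambda>x. \<Sum>i<n. g i x) has_integral I n) {a..b}"
    and J: "((\<lambda>x. \<Sum>i. g i x) has_integral J) {a..b}" and lim: "I \<longlonglongrightarrow> J"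
    by (rule uniform_limit_integral[OF ul cs]) auto
  have "I n = (\<Sum>i<n. integral {a..b} (g i))" for n
    using I[of n] integral_sum[of "{..<n}" g "{a..b}"] integrable_continuous_real[OF cont]
    by (metis (no_types, lifting) finite_lessThan integral_unique)
  then show "(\<lambda>i. integral {a..b} (g i)) sums integral {a..b} (\<lambda>x. \<Sum>i. g i x)"
    using lim integral_unique[OF J] unfolding sums_def by presburger
qed

section \<open>Cosine coefficients and Chebyshev series\<close>

definition cosine_coeff :: "(real \<Rightarrow> real) \<Rightarrow> nat \<Rightarrow> real" where
  "cosine_coeff f k = integral {0..pi} (\<lambda>\<theta>. f (cos \<theta>) * cos (real k * \<theta>))"

lemma continuous_on_cosine_coeff:
  assumes "continuous_on {-1..1} f"
  shows "continuous_on {0..pi} (\<lambda>\<theta>. f (cos \<theta>) * cos (real k * \<theta>))"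
  by (intro continuous_intros continuous_on_compose2[OF assms]) auto

lemma abs_cosine_coeff_le:
  assumes "continuous_on {-1..1} f" and "\<And>s. s \<in> {-1..1} \<Longrightarrow> \<bar>f s\<bar> \<le> M"
  shows "\<bar>cosine_coeff f k\<bar> \<le> M * pi"
proof -
  have "\<bar>f (cos \<theta>) * cos (real k * \<theta>)\<bar> \<le> M" for \<theta>
    using mult_mono[OF assms(2)[of "cos \<theta>"] abs_cos_le_one[of "real k * \<theta>"]]
      assms(2)[of "cos \<theta>"] by (simp add: abs_mult)
  then have "norm (integral {0..pi} (\<lambda>\<theta>. f (cos \<theta>) * cos (real k * \<theta>))) \<le> M * (pi - 0)"
    by (intro integral_bound continuous_on_cosine_coeff assms) auto
  then show ?thesis
    by (simp add: cosine_coeff_def)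
qed

text \<open>Integration by parts in theta: the boundary term contains sin(k theta), which vanishes
  at 0 and pi, and the remaining product sin(theta) sin(k theta) splits into a difference of cosines
  of neighbouring index.\<close>

lemma cosine_coeff_deriv:
  assumes deriv: "\<And>s. s \<in> {-1..1} \<Longrightarrow> (f has_real_derivative f' s) (at s within {-1..1})"
    and cont': "continuous_on {-1..1} f'" and "k > 0"
  shows "cosine_coeff f k = (cosine_coeff f' (k - 1) - cosine_coeff f' (k + 1)) / (2 * real k)"
proof -
  have cont: "continuous_on {-1..1} f"
    using deriv by (rule DERIV_continuous_on)
  have contfc: "continuous_on {0..pi} (\<lambda>\<theta>. f (cos \<theta>))"
    by (intro continuous_intros continuous_on_compose2[OF cont]) auto
  define g where "g \<theta> = f (cos \<theta>) * cos (real k * \<theta>) -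
     (f' (cos \<theta>) * cos (real (k - 1) * \<theta>) - f' (cos \<theta>) * cos (real (k + 1) * \<theta>)) / (2 * real k)"
    for \<theta>
  have "(g has_integral (f (cos pi) * sin (real k * pi) / real k
           - f (cos 0) * sin (real k * 0) / real k)) {0..pi}"
  \<comment> \<open>The derivative of f is one-sided at -1 and 1, so the chain rule is applied in
    the open interval only and continuity covers the end points.\<close>
  proof (rule fundamental_theorem_of_calculus_interior)
    show "continuous_on {0..pi} (\<lambda>\<theta>. f (cos \<theta>) * sin (real k * \<theta>) / real k)"
      using \<open>k > 0\<close> by (intro continuous_intros contfc) auto
  next
    fix \<theta> :: real
    assume th: "\<theta> \<in> {0<..<pi}"
    have "-1 < cos \<theta>" "cos \<theta> < 1"
      using cos_monotone_0_pi[of \<theta> pi] cos_monotone_0_pi[of 0 \<theta>] th by auto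
    then have "(f has_real_derivative f' (cos \<theta>)) (at (cos \<theta>))"
      using deriv[of "cos \<theta>"] by (simp add: at_within_Icc_at)
    then have "((\<lambda>\<theta>. f (cos \<theta>)) has_real_derivative (f' (cos \<theta>) * - sin \<theta>)) (at \<theta>)"
      by (rule DERIV_chain2[OF _ DERIV_cos])
    then have *: "((\<lambda>\<theta>. f (cos \<theta>) * sin (real k * \<theta>) / real k) has_real_derivative
        (f' (cos \<theta>) * - sin \<theta> * sin (real k * \<theta>) + cos (real k * \<theta>) * real k * f (cos \<theta>)) / real k) (at \<theta>)"
      using \<open>k > 0\<close> by (auto intro!: derivative_eq_intros)
    have "real (k - 1) * \<theta> = real k * \<theta> - \<theta>" "real (k + 1) * \<theta> = real k * \<theta> + \<theta>"
      using \<open>k > 0\<close> by (simp_all add: of_nat_diff algebra_simps)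
    then have "cos (real (k - 1) * \<theta>) - cos (real (k + 1) * \<theta>) = 2 * sin \<theta> * sin (real k * \<theta>)"
      by (simp add: cos_add cos_diff)
    then have "g \<theta> = f (cos \<theta>) * cos (real k * \<theta>) - f' (cos \<theta>) * (2 * sin \<theta> * sin (real k * \<theta>)) / (2 * real k)"
      by (simp add: g_def flip: right_diff_distrib)
    also have "\<dots> = (f' (cos \<theta>) * - sin \<theta> * sin (real k * \<theta>) + cos (real k * \<theta>) * real k * f (cos \<theta>)) / real k"
      using \<open>k > 0\<close> by (simp add: field_simps)
    finally show "((\<lambda>\<theta>. f (cos \<theta>) * sin (real k * \<theta>) / real k) has_vector_derivative g \<theta>) (at \<theta>)"
      using * by (simp add: has_real_derivative_iff_has_vector_derivative)
  qed auto
  then have "integral {0..pi} g = 0"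
    by (simp add: integral_unique)
  moreover have "integral {0..pi} g = cosine_coeff f k - (cosine_coeff f' (k - 1) - cosine_coeff f' (k + 1)) / (2 * real k)"
    unfolding g_def cosine_coeff_def
    by (simp only: integral_diff integral_divide integrable_diff integrable_on_divide
      integrable_continuous_real[OF continuous_on_cosine_coeff] cont cont')
  ultimately show ?thesis
    by simp
qed

lemma integral_cos_nat:
  "integral {0..pi} (\<lambda>\<theta>. cos (real k * \<theta>)) = (if k = 0 then pi else 0)"
proof (cases "k = 0")
  case False
  have "((\<lambda>\<theta>. cos (real k * \<theta>)) has_integral (sin (real k * pi) / real k - sin (real k * 0) / real k)) {0..pi}"
    using False
    by (intro fundamental_theorem_of_calculus)
      (auto intro!: derivative_eq_intros simp: simp flip: has_real_derivative_iff_has_vector_derivative)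
  with False show ?thesis
    by (simp add: integral_unique)
qed auto

text \<open>The conditional encodes the distance of k and m as a natural number, so that both
  resulting cosines have a natural index again and known integrals or grid sums apply to
  them.\<close>

lemma cos_prod_nat:
  "cos (real k * \<theta>) * cos (real m * \<theta>) =
     (cos (real (if k \<le> m then m - k else k - m) * \<theta>) + cos (real (k + m) * \<theta>)) / 2"
proof -
  have "cos (real (if k \<le> m then m - k else k - m) * \<theta>) = cos (real k * \<theta> - real m * \<theta>)"
    using cos_minus[of "real k * \<theta> - real m * \<theta>"] by (auto simp: of_nat_diff algebra_simps)
  then show ?thesis
    by (simp add: cos_times_cos algebra_simps)
qed

lemma integral_cos_cos:
  "integral {0..pi} (\<lambda>\<theta>. cos (real k * \<theta>) * cos (real m * \<theta>)) =
     (if k \<noteq> m then 0 else if k = 0 then pi else pi / 2)"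
proof -
  have int: "(\<lambda>\<theta>. cos (real j * \<theta>)) integrable_on {0..pi}" for j
    by (intro integrable_continuous_real continuous_intros)
  show ?thesis
    by (simp only: cos_prod_nat integral_divide integral_add[OF int int] integral_cos_nat) auto
qed

text \<open>Completeness of the cosine system. Vanishing coefficients make f(cos theta) orthogonal
  to every polynomial in cos theta. Approximating f by polynomials makes the integral of its square
  arbitrarily small, hence zero.\<close>

lemma cosine_coeff_eq_0_imp_eq_0:
  assumes cont: "continuous_on {-1..1} f" and zero: "\<And>k. cosine_coeff f k = 0"
    and s: "s \<in> {-1..1}"
  shows "f s = 0"
proof -
  have contp: "continuous_on {0..pi} (\<lambda>\<theta>. f (cos \<theta>) * cos \<theta> ^ m * cos (real k * \<theta>))" for m k
    by (intro continuous_intros continuous_on_compose2[OF cont]) auto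
  \<comment> \<open>The extra factor cos(k theta), with k arbitrary, closes the induction: one more
    factor cos(theta) averages the cases of index |k - 1| and k + 1.\<close>
  have moment: "integral {0..pi} (\<lambda>\<theta>. f (cos \<theta>) * cos \<theta> ^ m * cos (real k * \<theta>)) = 0" for m k
  proof (induction m arbitrary: k)
    case 0
    then show ?case
      using zero[of k] by (simp add: cosine_coeff_def)
  next
    case (Suc m)
    define j where "j = (if k \<le> 1 then 1 - k else k - 1)"
    have "f (cos \<theta>) * cos \<theta> ^ Suc m * cos (real k * \<theta>) =
        (f (cos \<theta>) * cos \<theta> ^ m * cos (real j * \<theta>) + f (cos \<theta>) * cos \<theta> ^ m * cos (real (k + 1) * \<theta>)) / 2" for \<theta>
    proof -
      have "f (cos \<theta>) * cos \<theta> ^ Suc m * cos (real k * \<theta>) = f (cos \<theta>) * cos \<theta> ^ m * (cos (real k * \<theta>) * cos (real 1 * \<theta>))"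
        by simp
      then show ?thesis
        unfolding cos_prod_nat[of k \<theta> 1] j_def[symmetric] by (simp add: algebra_simps)
    qed
    then have "integral {0..pi} (\<lambda>\<theta>. f (cos \<theta>) * cos \<theta> ^ Suc m * cos (real k * \<theta>)) =
        (integral {0..pi} (\<lambda>\<theta>. f (cos \<theta>) * cos \<theta> ^ m * cos (real j * \<theta>)) +
         integral {0..pi} (\<lambda>\<theta>. f (cos \<theta>) * cos \<theta> ^ m * cos (real (k + 1) * \<theta>))) / 2"
      by (simp only: integral_divide integral_add[OF integrable_continuous_real integrable_continuous_real, OF contp contp])
    then show ?case
      by (simp only: Suc.IH) simp
  qed
  have poly0: "integral {0..pi} (\<lambda>\<theta>. f (cos \<theta>) * p (cos \<theta>)) = 0" if p: "real_polynomial_function p" for p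
  proof -
    obtain a n where "p = (\<lambda>x. \<Sum>i\<le>n. a i * x ^ i)"
      using p real_polynomial_function_iff_sum by blast
    then have "integral {0..pi} (\<lambda>\<theta>. f (cos \<theta>) * p (cos \<theta>)) =
        integral {0..pi} (\<lambda>\<theta>. \<Sum>i\<le>n. a i * (f (cos \<theta>) * cos \<theta> ^ i * cos (real 0 * \<theta>)))"
      by (simp add: sum_distrib_left mult_ac)
    also have "\<dots> = (\<Sum>i\<le>n. integral {0..pi} (\<lambda>\<theta>. a i * (f (cos \<theta>) * cos \<theta> ^ i * cos (real 0 * \<theta>))))"
      by (intro integral_sum integrable_continuous_real continuous_on_mult_left contp) auto
    also have "\<dots> = 0"
      by (simp only: integral_mult_right moment) simp
    finally show ?thesis .
  qed
  have contf2: "continuous_on {0..pi} (\<lambda>\<theta>. (f (cos \<theta>))\<^sup>2)"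
    by (intro continuous_intros continuous_on_compose2[OF cont]) auto
  have "bounded (f ` {-1..1})"
    by (intro compact_imp_bounded compact_continuous_image cont) auto
  then obtain M where M: "\<And>s. s \<in> {-1..1} \<Longrightarrow> \<bar>f s\<bar> \<le> M"
    unfolding bounded_iff by (metis image_eqI real_norm_def)
  have small: "integral {0..pi} (\<lambda>\<theta>. (f (cos \<theta>))\<^sup>2) \<le> M * pi * e" if "e > 0" for e
  proof -
    obtain p where p: "real_polynomial_function p" and fp: "\<And>s. s \<in> {-1..1} \<Longrightarrow> \<bar>f s - p s\<bar> < e"
      using Stone_Weierstrass_real_polynomial_function[OF _ cont \<open>e > 0\<close>] by blast
    have contpc: "continuous_on {-1..1} p"
      using p continuous_on_polymonial_function real_polynomial_function_eq by blast
    have c1: "continuous_on {0..pi} (\<lambda>\<theta>. f (cos \<theta>) * p (cos \<theta>))"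
      by (intro continuous_intros continuous_on_compose2[OF cont] continuous_on_compose2[OF contpc]) auto
    have c2: "continuous_on {0..pi} (\<lambda>\<theta>. f (cos \<theta>) * (f (cos \<theta>) - p (cos \<theta>)))"
      by (intro continuous_intros continuous_on_compose2[OF cont] continuous_on_compose2[OF contpc]) auto
    \<comment> \<open>Split f^2 = f p + f (f - p): the first part integrates to zero by
      \<open>poly0\<close>, the second is at most M e pointwise.\<close>
    have "integral {0..pi} (\<lambda>\<theta>. (f (cos \<theta>))\<^sup>2) =
        integral {0..pi} (\<lambda>\<theta>. f (cos \<theta>) * p (cos \<theta>) + f (cos \<theta>) * (f (cos \<theta>) - p (cos \<theta>)))"
      by (simp add: power2_eq_square algebra_simps)
    also have "\<dots> = integral {0..pi} (\<lambda>\<theta>. f (cos \<theta>) * (f (cos \<theta>) - p (cos \<theta>)))"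
      by (subst integral_add) (use poly0[OF p] integrable_continuous_real c1 c2 in auto)
    also have "\<dots> \<le> norm \<dots>"
      by simp
    also have "\<dots> \<le> M * e * (pi - 0)"
    proof (rule integral_bound[OF _ c2])
      fix \<theta>
      have "\<bar>f (cos \<theta>)\<bar> * \<bar>f (cos \<theta>) - p (cos \<theta>)\<bar> \<le> M * e"
        using M[of "cos \<theta>"] fp[of "cos \<theta>"] by (intro mult_mono) auto
      then show "norm (f (cos \<theta>) * (f (cos \<theta>) - p (cos \<theta>))) \<le> M * e"
        by (simp add: abs_mult)
    qed auto
    finally show ?thesis
      by (simp add: mult_ac)
  qed
  have "M \<ge> 0"
    using M[of 0] by auto
  have "integral {0..pi} (\<lambda>\<theta>. (f (cos \<theta>))\<^sup>2) \<le> 0"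
  proof (rule field_le_epsilon)
    fix e :: real
    assume "e > 0"
    \<comment> \<open>The summand 1 keeps the denominator positive when M = 0.\<close>
    have "integral {0..pi} (\<lambda>\<theta>. (f (cos \<theta>))\<^sup>2) \<le> M * pi * (e / (M * pi + 1))"
      using \<open>e > 0\<close> \<open>M \<ge> 0\<close> by (intro small divide_pos_pos add_nonneg_pos) auto
    also have "\<dots> \<le> e"
    proof -
      have "M * pi + 1 > 0"
        using \<open>M \<ge> 0\<close> by (intro add_nonneg_pos) auto
      with \<open>e > 0\<close> show ?thesis
        by (simp add: pos_divide_le_eq algebra_simps)
    qed
    finally show "integral {0..pi} (\<lambda>\<theta>. (f (cos \<theta>))\<^sup>2) \<le> 0 + e"
      by simp
  qed
  moreover have "integral {0..pi} (\<lambda>\<theta>. (f (cos \<theta>))\<^sup>2) \<ge> 0"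
    by (intro integral_nonneg integrable_continuous_real contf2) auto
  ultimately have "\<forall>\<theta>\<in>{0..pi}. (f (cos \<theta>))\<^sup>2 = 0"
    using integral_eq_0_iff[OF contf2] by auto
  moreover have "arccos s \<in> {0..pi}" "cos (arccos s) = s"
    using s by (auto simp: arccos_lbound arccos_ubound cos_arccos)
  ultimately show ?thesis
    by force
qed

text \<open>The substitution s = cos theta has absorbed the weight 1 / sqrt(1 - s^2), so these are
  the usual Chebyshev coefficients. The factor is the reciprocal of the integral of cos(k theta)^2,
  which is pi for k = 0 and pi / 2 otherwise.\<close>

definition cheb_coeff :: "(real \<Rightarrow> real) \<Rightarrow> nat \<Rightarrow> real" where
  "cheb_coeff f k = (if k = 0 then 1 else 2) / pi * cosine_coeff f k"

lemma continuous_on_cheb_T: "continuous_on {-1..1} (cheb_T k)"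
  unfolding cheb_T_def by (intro continuous_intros) auto

lemma cheb_T_cos: "\<theta> \<in> {0..pi} \<Longrightarrow> cheb_T k (cos \<theta>) = cos (real k * \<theta>)"
  by (simp add: cheb_T_def arccos_cos)

lemma abs_cheb_T_le_1: "\<bar>cheb_T k s\<bar> \<le> 1"
  by (simp add: cheb_T_def)

text \<open>Absolute summability makes the series converge uniformly to a continuous
  \<open>u\<close>. Termwise integration and orthogonality give \<open>u\<close> the cosine
  coefficients of f, and completeness forces u = f.\<close>

lemma cheb_expansion:
  assumes cont: "continuous_on {-1..1} f" and summ: "summable (\<lambda>k. \<bar>cheb_coeff f k\<bar>)"
    and s: "s \<in> {-1..1}"
  shows "(\<lambda>k. cheb_coeff f k * cheb_T k s) sums f s"
proof -
  let ?c = "cheb_coeff f"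
  define u where "u s = (\<Sum>k. ?c k * cheb_T k s)" for s
  have le: "\<bar>?c k * x\<bar> \<le> \<bar>?c k\<bar>" if "\<bar>x\<bar> \<le> 1" for k x
    using mult_left_mono[OF that, of "\<bar>?c k\<bar>"] by (simp add: abs_mult)
  have contu: "continuous_on {-1..1} u"
    unfolding u_def
    by (rule continuous_on_suminf[OF _ _ summ]) (auto intro!: continuous_intros continuous_on_cheb_T le abs_cheb_T_le_1)
  have coeffu: "cosine_coeff u m = cosine_coeff f m" for m
  proof -
    let ?g = "\<lambda>k \<theta>. ?c k * cos (real k * \<theta>) * cos (real m * \<theta>)"
    have sumc: "summable (\<lambda>k. ?c k * cos (real k * \<theta>))" for \<theta>
      by (rule summable_comparison_test'[OF summ]) (simp add: le)
    have "\<bar>?g k \<theta>\<bar> \<le> \<bar>?c k\<bar>" for k \<theta>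
      using mult_mono[OF abs_cos_le_one abs_cos_le_one, of "real k * \<theta>" "real m * \<theta>"]
      by (simp only: mult.assoc) (rule le, simp add: abs_mult mult.commute)
    then have "(\<lambda>k. integral {0..pi} (?g k)) sums integral {0..pi} (\<lambda>\<theta>. \<Sum>k. ?g k \<theta>)"
      by (intro sums_integral_suminf[OF _ _ summ]) (auto intro!: continuous_intros)
    moreover have "integral {0..pi} (\<lambda>\<theta>. \<Sum>k. ?g k \<theta>) = cosine_coeff u m"
      unfolding cosine_coeff_def u_def
      by (intro integral_cong) (simp add: cheb_T_cos suminf_mult2[OF sumc])
    moreover have "integral {0..pi} (?g k) = (if k = m then cosine_coeff f m else 0)" for k
      by (simp add: mult.assoc integral_cos_cos cheb_coeff_def)
    ultimately have "(\<lambda>k. if k = m then cosine_coeff f m else 0) sums cosine_coeff u m"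
      by simp
    moreover have "(\<lambda>k. if k = m then cosine_coeff f m else 0) sums cosine_coeff f m"
      by (rule sums_single)
    ultimately show ?thesis
      by (rule sums_unique2)
  qed
  have "f s - u s = 0"
  proof (rule cosine_coeff_eq_0_imp_eq_0[OF _ _ s])
    show "continuous_on {-1..1} (\<lambda>s. f s - u s)"
      by (intro continuous_intros cont contu)
    have "cosine_coeff (\<lambda>s. f s - u s) k = cosine_coeff f k - cosine_coeff u k" for k
      unfolding cosine_coeff_def left_diff_distrib
      by (intro integral_diff integrable_continuous_real continuous_on_cosine_coeff cont contu)
    then show "cosine_coeff (\<lambda>s. f s - u s) k = 0" for k
      by (simp add: coeffu)
  qed
  moreover have "summable (\<lambda>k. ?c k * cheb_T k s)"
    by (rule summable_comparison_test'[OF summ]) (simp add: le abs_cheb_T_le_1)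
  ultimately show ?thesis
    by (auto simp: u_def dest: summable_sums)
qed

section \<open>Uniform decay of Chebyshev coefficients\<close>

definition unif_C0 :: "'t set \<Rightarrow> real set \<Rightarrow> ('t \<Rightarrow> real \<Rightarrow> real) \<Rightarrow> bool" where
  "unif_C0 T S F \<longleftrightarrow> (\<exists>M. \<forall>t\<in>T. continuous_on S (F t) \<and> (\<forall>s\<in>S. \<bar>F t s\<bar> \<le> M))"

text \<open>The parameter t is a mere label: no regularity in t is asked, but every derivative in s
  has one bound for all t. This makes the final constant the same for all collocation nodes.\<close>

primrec unif_Ck :: "nat \<Rightarrow> 't set \<Rightarrow> real set \<Rightarrow> ('t \<Rightarrow> real \<Rightarrow> real) \<Rightarrow> bool" where
  "unif_Ck 0 T S F \<longleftrightarrow> unif_C0 T S F"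
| "unif_Ck (Suc r) T S F \<longleftrightarrow> unif_C0 T S F \<and>
     (\<exists>F'. (\<forall>t\<in>T. \<forall>s\<in>S. (F t has_real_derivative F' t s) (at s within S)) \<and> unif_Ck r T S F')"

lemma unif_Ck_imp_unif_C0: "unif_Ck r T S F \<Longrightarrow> unif_C0 T S F"
  by (cases r) auto

lemma unif_Ck_SucD: "unif_Ck (Suc r) T S F \<Longrightarrow> unif_Ck r T S F"
proof (induction r arbitrary: F)
  case (Suc r)
  then show ?case
    by (metis unif_Ck.simps(2))
qed auto

lemma unif_Ck_mono:
  assumes "unif_Ck p T S F" and "r \<le> p"
  shows "unif_Ck r T S F"
  using assms(2,1) by (induction rule: dec_induct) (auto intro: unif_Ck_SucD simp del: unif_Ck.simps)

lemma unif_C0_add: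
  assumes "unif_C0 T S F" and "unif_C0 T S G"
  shows "unif_C0 T S (\<lambda>t s. F t s + G t s)"
proof -
  obtain M N where "\<forall>t\<in>T. continuous_on S (F t) \<and> (\<forall>s\<in>S. \<bar>F t s\<bar> \<le> M)"
    "\<forall>t\<in>T. continuous_on S (G t) \<and> (\<forall>s\<in>S. \<bar>G t s\<bar> \<le> N)"
    using assms by (auto simp: unif_C0_def)
  then show ?thesis
    unfolding unif_C0_def
    by (intro exI[of _ "M + N"]) (auto intro!: continuous_intros abs_triangle_ineq[THEN order_trans] add_mono)
qed

lemma unif_C0_mult:
  assumes "unif_C0 T S F" and "unif_C0 T S G"
  shows "unif_C0 T S (\<lambda>t s. F t s * G t s)"
proof -
  obtain M N where "\<forall>t\<in>T. continuous_on S (F t) \<and> (\<forall>s\<in>S. \<bar>F t s\<bar> \<le> M)"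
    "\<forall>t\<in>T. continuous_on S (G t) \<and> (\<forall>s\<in>S. \<bar>G t s\<bar> \<le> N)"
    using assms by (auto simp: unif_C0_def)
  then show ?thesis
    unfolding unif_C0_def
    by (intro exI[of _ "M * N"]) (auto intro!: continuous_intros mult_mono' simp: abs_mult)
qed

lemma unif_Ck_add:
  "unif_Ck r T S F \<Longrightarrow> unif_Ck r T S G \<Longrightarrow> unif_Ck r T S (\<lambda>t s. F t s + G t s)"
proof (induction r arbitrary: F G)
  case (Suc r)
  then obtain F' G' where
    "\<forall>t\<in>T. \<forall>s\<in>S. (F t has_real_derivative F' t s) (at s within S)" "unif_Ck r T S F'"
    "\<forall>t\<in>T. \<forall>s\<in>S. (G t has_real_derivative G' t s) (at s within S)" "unif_Ck r T S G'"
    by auto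
  with Suc show ?case
    by (auto intro!: unif_C0_add DERIV_add exI[of _ "\<lambda>t s. F' t s + G' t s"])
qed (simp add: unif_C0_add)

lemma unif_Ck_mult:
  "unif_Ck r T S F \<Longrightarrow> unif_Ck r T S G \<Longrightarrow> unif_Ck r T S (\<lambda>t s. F t s * G t s)"
proof (induction r arbitrary: F G)
  case (Suc r)
  then obtain F' G' where
    *: "\<forall>t\<in>T. \<forall>s\<in>S. (F t has_real_derivative F' t s) (at s within S)" "unif_Ck r T S F'"
    "\<forall>t\<in>T. \<forall>s\<in>S. (G t has_real_derivative G' t s) (at s within S)" "unif_Ck r T S G'"
    by auto
  \<comment> \<open>The product rule pairs each derivative with an undifferentiated factor, which is
    lowered to order r before the induction hypothesis applies.\<close>
  have "unif_Ck r T S (\<lambda>t s. F' t s * G t s + G' t s * F t s)"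
    using * Suc.prems[THEN unif_Ck_SucD] by (intro unif_Ck_add Suc.IH)
  with * Suc.prems show ?case
    by (auto intro!: unif_C0_mult DERIV_mult exI[of _ "\<lambda>t s. F' t s * G t s + G' t s * F t s"])
qed (simp add: unif_C0_mult)

text \<open>Along a line of direction v the s-derivatives are iterated directional derivatives along
  v, and compactness of U bounds each of them independently of the base point. It serves the kernel
  with t frozen as well as the solution x.\<close>

lemma Ck_on_imp_unif_Ck_line:
  fixes f :: "'a::real_normed_vector \<Rightarrow> real"
  assumes "Ck_on r U f" and "compact U"
    and "\<And>t s. t \<in> T \<Longrightarrow> s \<in> S \<Longrightarrow> p t + s *\<^sub>R v \<in> U"
  shows "unif_Ck r T S (\<lambda>t s. f (p t + s *\<^sub>R v))"
  using assms(1)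
proof (induction r arbitrary: f)
  have C0: "unif_C0 T S (\<lambda>t s. f (p t + s *\<^sub>R v))" if cont: "continuous_on U f" for f :: "'a \<Rightarrow> real"
  proof -
    have "bounded (f ` U)"
      using cont \<open>compact U\<close> by (intro compact_imp_bounded compact_continuous_image)
    then obtain M where "\<And>x. x \<in> U \<Longrightarrow> \<bar>f x\<bar> \<le> M"
      unfolding bounded_iff by (metis image_eqI real_norm_def)
    then show ?thesis
      unfolding unif_C0_def using assms(3)
      by (intro exI[of _ M]) (auto intro!: continuous_intros continuous_on_compose2[OF cont])
  qed
  {
    case 0
    then show ?case
      by (simp add: C0)
  next
    case (Suc r)
    then obtain f' where f': "\<And>x. x \<in> U \<Longrightarrow> (f has_derivative f' x) (at x within U)"
      and Ck: "\<And>v. Ck_on r U (\<lambda>x. f' x v)"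
      by auto
    have "continuous_on U f"
      using f' by (rule has_derivative_continuous_on)
    moreover have "((\<lambda>s. f (p t + s *\<^sub>R v)) has_real_derivative f' (p t + s *\<^sub>R v) v) (at s within S)"
      if "t \<in> T" "s \<in> S" for t s
    proof -
      have lin: "linear (f' (p t + s *\<^sub>R v))"
        using f'[OF assms(3)[OF that]] has_derivative_linear by blast
      have "((\<lambda>s. p t + s *\<^sub>R v) has_derivative (\<lambda>h. h *\<^sub>R v)) (at s within S)"
        by (auto intro!: derivative_eq_intros)
      \<comment> \<open>The line may run along the boundary of U, where only derivatives relative to
        U exist, so the chain rule is used within the image of S.\<close>
      moreover have "(f has_derivative f' (p t + s *\<^sub>R v)) (at (p t + s *\<^sub>R v) within (\<lambda>s. p t + s *\<^sub>R v) ` S)"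
        by (rule has_derivative_subset[OF f']) (use assms(3) that in auto)
      ultimately have "((\<lambda>s. f (p t + s *\<^sub>R v)) has_derivative (\<lambda>h. f' (p t + s *\<^sub>R v) (h *\<^sub>R v))) (at s within S)"
        by (rule has_derivative_in_compose)
      then show ?thesis
        unfolding has_field_derivative_def linear_cmul[OF lin] real_scaleR_def
        by (simp add: mult.commute[of _ "f' (p t + s *\<^sub>R v) v"])
    qed
    ultimately show ?case
      using Suc.IH[OF Ck[of v]]
      by (auto simp: C0 intro!: exI[of _ "\<lambda>t s. f' (p t + s *\<^sub>R v) v"])
  }
qed

text \<open>Each derivative gains one factor 1/k through \<open>cosine_coeff_deriv\<close>. Writing
  k + 1 in the denominator keeps the bound meaningful at k = 0.\<close>

lemma unif_Ck_cosine_coeff_decay: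
  assumes "unif_Ck r T {-1..1} F"
  shows "\<exists>C. \<forall>t\<in>T. \<forall>k. \<bar>cosine_coeff (F t) k\<bar> \<le> C / (real k + 1) ^ r"
  using assms
proof (induction r arbitrary: F)
  case 0
  then obtain M where M: "\<forall>t\<in>T. continuous_on {-1..1} (F t) \<and> (\<forall>s\<in>{-1..1}. \<bar>F t s\<bar> \<le> M)"
    by (auto simp: unif_C0_def)
  then show ?case
    by (intro exI[of _ "M * pi"]) (auto intro!: abs_cosine_coeff_le)
next
  case (Suc r)
  then obtain F' M where
    M: "\<And>t. t \<in> T \<Longrightarrow> continuous_on {-1..1} (F t)" "\<And>t s. t \<in> T \<Longrightarrow> s\<in>{-1..1} \<Longrightarrow> \<bar>F t s\<bar> \<le> M"
    and F': "\<And>t s. t \<in> T \<Longrightarrow> s\<in>{-1..1} \<Longrightarrow> (F t has_real_derivative F' t s) (at s within {-1..1})"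
    and Ck: "unif_Ck r T {-1..1} F'"
    unfolding unif_Ck.simps unif_C0_def by blast
  obtain C where C: "\<And>t k. t \<in> T \<Longrightarrow> \<bar>cosine_coeff (F' t) k\<bar> \<le> C / (real k + 1) ^ r"
    using Suc.IH[OF Ck] by blast
  have contF': "continuous_on {-1..1} (F' t)" if "t \<in> T" for t
    using unif_Ck_imp_unif_C0[OF Ck] that by (auto simp: unif_C0_def)
  show ?case
  proof (intro exI[of _ "max (M * pi) (C * 2 ^ Suc r)"] ballI allI)
    fix t k
    assume t: "t \<in> T"
    \<comment> \<open>The sign of C can only be read off once some t in T is given, since T may be
      empty.\<close>
    have "C \<ge> 0"
      using C[OF t, of 0] by (simp add: order_trans[OF abs_ge_zero])
    show "\<bar>cosine_coeff (F t) k\<bar> \<le> max (M * pi) (C * 2 ^ Suc r) / (real k + 1) ^ Suc r"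
    proof (cases "k = 0")
      case True
      then show ?thesis
        using abs_cosine_coeff_le[OF M(1)[OF t] M(2)[OF t], of 0] by auto
    next
      case False
      have "\<bar>cosine_coeff (F t) k\<bar> = \<bar>cosine_coeff (F' t) (k - 1) - cosine_coeff (F' t) (k + 1)\<bar> / (2 * real k)"
        using False cosine_coeff_deriv[OF F'[OF t] contF'[OF t], of k] by (simp add: abs_divide)
      also have "\<dots> \<le> (C / real k ^ r + C / real k ^ r) / (2 * real k)"
      proof (rule divide_right_mono)
        have "\<bar>cosine_coeff (F' t) (k - 1)\<bar> \<le> C / real k ^ r"
          using C[OF t, of "k - 1"] False by (simp add: of_nat_diff)
        moreover have "\<bar>cosine_coeff (F' t) (k + 1)\<bar> \<le> C / real k ^ r"
          using False \<open>C \<ge> 0\<close>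
          by (intro order_trans[OF C[OF t]] divide_left_mono power_mono) auto
        ultimately show "\<bar>cosine_coeff (F' t) (k - 1) - cosine_coeff (F' t) (k + 1)\<bar> \<le> C / real k ^ r + C / real k ^ r"
          by linarith
      qed simp
      also have "\<dots> = C / real k ^ Suc r"
        by simp
      also have "\<dots> = C * 2 ^ Suc r / (2 * real k) ^ Suc r"
        by (simp add: power_mult_distrib)
      also have "\<dots> \<le> C * 2 ^ Suc r / (real k + 1) ^ Suc r"
        using False \<open>C \<ge> 0\<close> by (intro divide_left_mono power_mono mult_pos_pos zero_less_power) auto
      also have "\<dots> \<le> max (M * pi) (C * 2 ^ Suc r) / (real k + 1) ^ Suc r"
        by (intro divide_right_mono) auto
      finally show ?thesis .
    qed
  qed
qed

section \<open>Tails of inverse power series\<close>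

lemma summable_inverse_power:
  assumes "r \<ge> 2"
  shows "summable (\<lambda>k. C / (real k + 1) ^ r)"
proof -
  have "summable (\<lambda>k. inverse (real (k + 1) ^ r))"
    using inverse_power_summable[OF assms, where 'a = real] by (rule summable_ignore_initial_segment)
  from summable_mult[OF this, of C] show ?thesis
    by (simp add: field_simps)
qed

text \<open>Of the r factors, r - 2 are bounded by 1/n each. The remaining 1/(m+1)^2 is at most
  1/(m(m+1)) = 1/m - 1/(m+1), which telescopes to at most 1/n.\<close>

lemma suminf_inverse_power_tail_le:
  assumes r: "r \<ge> 2" and n: "n \<ge> 1" and "C \<ge> 0"
  shows "(\<Sum>k. C / (real (k + n) + 1) ^ r) \<le> C / real n ^ (r - 1)"
proof (rule suminf_le_const)
  show "summable (\<lambda>k. C / (real (k + n) + 1) ^ r)"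
    using summable_inverse_power[OF r] by (rule summable_ignore_initial_segment)
  have step: "1 / (real (k + n) + 1) ^ r \<le> (1 / real (k + n) - 1 / real (k + n + 1)) / real n ^ (r - 2)" for k
  proof -
    obtain q where q: "r = q + 2"
      using r by (metis add.commute le_Suc_ex)
    let ?m = "real (k + n)"
    have m: "?m \<ge> real n" "real n > 0"
      using n by auto
    have "1 / (?m + 1) ^ r = 1 / (?m + 1) ^ q * (1 / (?m + 1)^2)"
      by (simp add: q power_add power2_eq_square)
    also have "\<dots> \<le> 1 / real n ^ q * (1 / (?m * (?m + 1)))"
    proof (rule mult_mono)
      show "1 / (?m + 1) ^ q \<le> 1 / real n ^ q"
        using m by (intro divide_left_mono power_mono mult_pos_pos zero_less_power) auto
      show "1 / (?m + 1)^2 \<le> 1 / (?m * (?m + 1))"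
        using m unfolding power2_eq_square by (intro divide_left_mono mult_right_mono mult_pos_pos) auto
    qed auto
    also have "1 / (?m * (?m + 1)) = 1 / ?m - 1 / real (k + n + 1)"
      using m by (simp add: divide_simps)
    finally show ?thesis
      by (simp add: q)
  qed
  fix N
  have "(\<Sum>k<N. 1 / (real (k + n) + 1) ^ r) \<le> (\<Sum>k<N. (1 / real (k + n) - 1 / real (k + n + 1)) / real n ^ (r - 2))"
    by (intro sum_mono step)
  also have "\<dots> = (1 / real n - 1 / real (N + n)) / real n ^ (r - 2)"
    using sum_lessThan_telescope'[of "\<lambda>k. 1 / real (k + n)" N]
    by (simp flip: sum_divide_distrib)
  also have "\<dots> \<le> (1 / real n) / real n ^ (r - 2)"
    by (intro divide_right_mono) auto
  also have "\<dots> = 1 / real n ^ (r - 1)"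
  proof -
    have "r - 1 = Suc (r - 2)"
      using r by simp
    then show ?thesis
      by simp
  qed
  finally show "(\<Sum>k<N. C / (real (k + n) + 1) ^ r) \<le> C / real n ^ (r - 1)"
    using mult_left_mono[OF _ \<open>C \<ge> 0\<close>] by (fastforce simp: sum_distrib_left)
qed

section \<open>Spectral integration\<close>

lemma integral_cheb_T:
  assumes "-1 \<le> u" "u \<le> v" "v \<le> 1"
  shows "integral {u..v} (cheb_T m) =
    (if m = 0 then cheb_T 1 v - cheb_T 1 u
     else (cheb_T (m + 1) v - cheb_T (m + 1) u) / (2 * real (m + 1))
        \<comment> \<open>for \<open>m = 1\<close> the second term is \<open>0 / 0 = 0\<close>\<close>
        - (cheb_T (m - 1) v - cheb_T (m - 1) u) / (2 * real (m - 1)))"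
proof -
  define A where "A s = (if m = 0 then cheb_T 1 s
     else cheb_T (m + 1) s / (2 * real (m + 1)) - cheb_T (m - 1) s / (2 * real (m - 1)))" for s
  have "(cheb_T m has_integral (A v - A u)) {u..v}"
  proof (rule fundamental_theorem_of_calculus_interior)
    have cont: "continuous_on {u..v} (cheb_T k)" for k
      by (rule continuous_on_subset[OF continuous_on_cheb_T]) (use assms in auto)
    \<comment> \<open>As a linear combination with constant coefficients, \<open>A\<close> can be
      differentiated term by term. The coefficient 0 for m <= 1 replaces the quotient by zero at m =
      1.\<close>
    have A_alt: "A = (\<lambda>s. (if m = 0 then 1 else 1 / (2 * real (m + 1))) * cheb_T (m + 1) s -
        (if m \<le> 1 then 0 else 1 / (2 * real (m - 1))) * cheb_T (m - 1) s)"
      by (auto simp: A_def fun_eq_iff)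
    show "continuous_on {u..v} A"
      unfolding A_alt by (intro continuous_intros cont)
    \<comment> \<open>Interior points only: the derivative of arccos blows up at -1 and 1.\<close>
    fix s
    assume "s \<in> {u<..<v}"
    then have s: "-1 < s" "s < 1"
      using assms by auto
    define \<theta> where "\<theta> = arccos s"
    have sin: "sin \<theta> = sqrt (1 - s\<^sup>2)" "sin \<theta> > 0"
      using s by (auto simp: \<theta>_def sin_arccos power2_less_1_iff abs_less_iff abs_square_less_1)
    have dT: "(cheb_T k has_real_derivative (real k * sin (real k * \<theta>) / sin \<theta>)) (at s)" for k
      unfolding cheb_T_def
      by (rule derivative_eq_intros DERIV_arccos s refl)+ (use sin in \<open>simp add: \<theta>_def field_simps\<close>)
    have "(A has_real_derivative
       (if m = 0 then 1 else 1 / (2 * real (m + 1))) * (real (m + 1) * sin (real (m + 1) * \<theta>) / sin \<theta>) -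
       (if m \<le> 1 then 0 else 1 / (2 * real (m - 1))) * (real (m - 1) * sin (real (m - 1) * \<theta>) / sin \<theta>)) (at s)"
      unfolding A_alt by (intro DERIV_diff DERIV_cmult dT)
    also have "(if m = 0 then 1 else 1 / (2 * real (m + 1))) * (real (m + 1) * sin (real (m + 1) * \<theta>) / sin \<theta>) -
       (if m \<le> 1 then 0 else 1 / (2 * real (m - 1))) * (real (m - 1) * sin (real (m - 1) * \<theta>) / sin \<theta>) =
       cheb_T m s"
    proof (cases "m = 0")
      case True
      then show ?thesis
        using sin by (simp add: cheb_T_def)
    next
      case False
      have "real (m + 1) * \<theta> = real m * \<theta> + \<theta>" "real (m - 1) * \<theta> = real m * \<theta> - \<theta>"
        using False by (simp_all add: of_nat_diff algebra_simps)
      then have "sin (real (m + 1) * \<theta>) - sin (real (m - 1) * \<theta>) = 2 * sin \<theta> * cos (real m * \<theta>)"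
        by (simp add: sin_add sin_diff)
      moreover have "(1 / (2 * real (m + 1))) * (real (m + 1) * sin (real (m + 1) * \<theta>) / sin \<theta>)
          = sin (real (m + 1) * \<theta>) / (2 * sin \<theta>)"
        using mult_divide_mult_cancel_left[of "real (m + 1)" "sin (real (m + 1) * \<theta>)" "2 * sin \<theta>"]
        by (simp add: mult_ac del: of_nat_add)
      moreover have "(if m \<le> 1 then 0 else 1 / (2 * real (m - 1))) * (real (m - 1) * sin (real (m - 1) * \<theta>) / sin \<theta>)
          = sin (real (m - 1) * \<theta>) / (2 * sin \<theta>)"
      proof (cases "m = 1")
        case False
        then show ?thesis
          using \<open>m \<noteq> 0\<close> mult_divide_mult_cancel_left[of "real (m - 1)" "sin (real (m - 1) * \<theta>)" "2 * sin \<theta>"]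
          by (simp add: mult_ac del: of_nat_diff)
      qed simp
      ultimately show ?thesis
        using sin False by (simp add: cheb_T_def \<theta>_def flip: diff_divide_distrib)
    qed
    finally show "(A has_vector_derivative cheb_T m s) (at s)"
      by (simp add: has_real_derivative_iff_has_vector_derivative)
  qed fact
  then show ?thesis
    by (simp add: integral_unique A_def diff_divide_distrib)
qed

text \<open>Below row 0, column m has nonzero entries at most in rows m - 1 and m + 1, the
  coefficients of an antiderivative of T_m. For m = n the row n + 1 is cut off. Otherwise, with d l
  = T_l(v) - T_l(u), the result agrees with \<open>integral_cheb_T\<close>.\<close>

lemma sum_B_mat:
  assumes "m \<le> n" "n \<ge> 1"
  shows "(\<Sum>l=1..n. B_mat n $$ (l, m) * d l) =
    (if m = 0 then d 1
     else (if m < n then d (m + 1) / (2 * real (m + 1)) else 0) - (if m = 1 then 0 else d (m - 1) / (2 * real (m - 1))))"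
proof -
  have "(\<Sum>l=1..n. B_mat n $$ (l, m) * d l) =
    (\<Sum>l=1..n. (if l = m + 1 then (if m = 0 then d 1 else d (m + 1) / (2 * real (m + 1))) else 0)
      - (if l = m - 1 then (if m \<le> 1 then 0 else d (m - 1) / (2 * real (m - 1))) else 0))"
  proof (rule sum.cong)
    fix l
    assume "l \<in> {1..n}"
    then have l: "1 \<le> l" "l \<le> n"
      by auto
    consider "l = m + 1" | "m = l + 1" | "l \<noteq> m + 1" "m \<noteq> l + 1"
      by blast
    then show "B_mat n $$ (l, m) * d l =
        (if l = m + 1 then (if m = 0 then d 1 else d (m + 1) / (2 * real (m + 1))) else 0)
      - (if l = m - 1 then (if m \<le> 1 then 0 else d (m - 1) / (2 * real (m - 1))) else 0)"
      using l \<open>m \<le> n\<close> by cases (auto simp: B_mat_def)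
  qed simp
  also have "\<dots> = (if m = 0 then d 1
     else (if m < n then d (m + 1) / (2 * real (m + 1)) else 0) - (if m = 1 then 0 else d (m - 1) / (2 * real (m - 1))))"
    unfolding sum_subtractf using assms by auto
  finally show ?thesis .
qed

section \<open>Chebyshev nodes, aliasing and the quadrature error\<close>

definition theta :: "nat \<Rightarrow> nat \<Rightarrow> real" where
  "theta n k = (2 * real k + 1) * pi / (2 * (real n + 1))"

lemma theta_in: "k \<le> n \<Longrightarrow> theta n k \<in> {0..pi}"
proof -
  assume "k \<le> n"
  then have "(2 * real k + 1) * pi \<le> (2 * (real n + 1)) * pi"
    by (intro mult_right_mono) auto
  then show ?thesis
    by (simp add: theta_def pos_divide_le_eq mult.commute)
qed

lemma tau_eq_cos_theta: "tau n k = cos (theta n k)"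
  by (simp add: tau_def theta_def)

lemma tau_in: "tau n k \<in> {-1..1}"
  by (simp add: tau_def)

lemma cheb_T_tau: "k \<le> n \<Longrightarrow> cheb_T m (tau n k) = cos (real m * theta n k)"
  using theta_in by (simp add: tau_eq_cos_theta cheb_T_cos)

text \<open>The grid angles are zeros of cos((n+1) theta), so replacing k by |k - 2(n+1)| only flips
  the sign on the grid. For k > n + 1 this lowers the index. The descent ends at some index up to n,
  or at n + 1, where the cosine vanishes and sigma = 0.\<close>

lemma cos_theta_alias:
  "\<exists>m \<sigma>. m \<le> n \<and> \<bar>\<sigma>\<bar> \<le> (1::real) \<and> (\<forall>j. cos (real k * theta n j) = \<sigma> * cos (real m * theta n j))"
proof (induction k rule: less_induct)
  case (less k)
  have zero: "cos (real (n + 1) * theta n j) = 0" for j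
  proof -
    have "real (n + 1) * theta n j = real j * pi + pi / 2"
      by (simp add: theta_def field_simps)
    then show ?thesis
      by (simp add: cos_add)
  qed
  consider "k \<le> n" | "k = n + 1" | "k > n + 1"
    by linarith
  then show ?case
  proof cases
    case 1
    then show ?thesis
      by (intro exI[of _ k] exI[of _ 1]) auto
  next
    case 2
    then show ?thesis
      using zero by (intro exI[of _ 0]) auto
  next
    case 3
    define k' where "k' = (if k \<le> 2 * (n + 1) then 2 * (n + 1) - k else k - 2 * (n + 1))"
    have "k' < k"
      using 3 by (auto simp: k'_def)
    have refl: "cos (real k * theta n j) = - cos (real k' * theta n j)" for j
    proof -
      define z where "z = real (n + 1) * theta n j"
      \<comment> \<open>Consequently cos(2z) = -1 and sin(2z) = 0, so the addition formula leaves
        only the sign change.\<close>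
      have z: "cos z = 0" "(sin z)\<^sup>2 = 1"
        using zero[of j] sin_squared_eq[of z] by (simp_all add: z_def)
      have "cos (real k' * theta n j) = cos (2 * z - real k * theta n j)"
        using cos_minus[of "2 * z - real k * theta n j"]
        by (auto simp: k'_def z_def of_nat_diff algebra_simps)
      also have "\<dots> = - cos (real k * theta n j)"
        by (simp add: cos_diff cos_double sin_double z)
      finally show ?thesis
        by simp
    qed
    obtain m \<sigma> where "m \<le> n" "\<bar>\<sigma>\<bar> \<le> (1::real)" "\<forall>j. cos (real k' * theta n j) = \<sigma> * cos (real m * theta n j)"
      using less[OF \<open>k' < k\<close>] by blast
    then show ?thesis
      using refl by (intro exI[of _ m] exI[of _ "- \<sigma>"]) auto
  qed
qed

text \<open>
  The rule is exact on \<open>T\<^sub>k\<close> for \<open>k < n\<close> only: the antiderivative of \<open>T\<^sub>n\<close> has degree \<open>n + 1\<close>,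
  and \<open>B_mat\<close> drops its leading coefficient. For larger \<open>k\<close>, aliasing bounds the discrete sum.
\<close>

lemma spectral_quadrature_error:
  assumes n: "n \<ge> 1" and uv: "-1 \<le> u" "u \<le> v" "v \<le> 1"
    and w: "\<And>m. m \<le> n \<Longrightarrow> (\<Sum>j\<le>n. w j * cheb_T m (tau n j)) =
      (\<Sum>l=1..n. B_mat n $$ (l, m) * (cheb_T l v - cheb_T l u))"
    and cont: "continuous_on {-1..1} f" and summ: "summable (\<lambda>k. \<bar>cheb_coeff f k\<bar>)"
  shows "\<bar>(\<Sum>j\<le>n. w j * f (tau n j)) - integral {u..v} f\<bar> \<le> 5 * (\<Sum>k. \<bar>cheb_coeff f (k + n)\<bar>)"
proof -
  let ?c = "cheb_coeff f"
  let ?d = "\<lambda>l. cheb_T l v - cheb_T l u"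
  define E where "E k = (\<Sum>j\<le>n. w j * cheb_T k (tau n j)) - integral {u..v} (cheb_T k)" for k
  have d: "\<bar>?d l\<bar> \<le> 2" for l
    using abs_cheb_T_le_1[of l u] abs_cheb_T_le_1[of l v] by linarith
  \<comment> \<open>The 2 in the denominator absorbs the bound 2 on the difference; for m = 0 the
    quotient is 0 by convention.\<close>
  have frac: "\<bar>?d l / (2 * real m)\<bar> \<le> 1" for l m
  proof (cases "m = 0")
    case False
    then show ?thesis
      using d[of l] by (simp add: abs_divide field_simps)
  qed auto
  have E0: "E k = 0" if "k < n" for k
    using that unfolding E_def w[OF less_imp_le[OF that]] sum_B_mat[OF less_imp_le[OF that] n] integral_cheb_T[OF uv]
    by auto
  have wle: "\<bar>\<Sum>j\<le>n. w j * cheb_T m (tau n j)\<bar> \<le> 3" if "m \<le> n" for m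
    unfolding w[OF that] sum_B_mat[OF that n]
    using d[of 1] frac[of "m + 1" "m + 1"] frac[of "m - 1" "m - 1"] by (smt (verit))
  \<comment> \<open>5 = 3 + 2: aliasing and \<open>wle\<close> bound the discrete sum by 3, and the
    integral is at most v - u <= 2.\<close>
  have E5: "\<bar>E k\<bar> \<le> 5" for k
  proof -
    obtain m \<sigma> where m: "m \<le> n" "\<bar>\<sigma>\<bar> \<le> (1::real)"
      and grid_eq: "\<And>j. cos (real k * theta n j) = \<sigma> * cos (real m * theta n j)"
      using cos_theta_alias[of n k] by blast
    have "(\<Sum>j\<le>n. w j * cheb_T k (tau n j)) = (\<Sum>j\<le>n. w j * (\<sigma> * cheb_T m (tau n j)))"
      by (intro sum.cong) (auto simp: cheb_T_tau grid_eq)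
    also have "\<dots> = \<sigma> * (\<Sum>j\<le>n. w j * cheb_T m (tau n j))"
      by (simp add: sum_distrib_left mult_ac)
    finally have "\<bar>\<Sum>j\<le>n. w j * cheb_T k (tau n j)\<bar> \<le> 1 * 3"
      unfolding abs_mult using m wle by (auto simp only: abs_mult intro!: mult_mono)
    moreover have "norm (integral {u..v} (cheb_T k)) \<le> 1 * (v - u)"
      by (rule integral_bound)
        (use uv in \<open>auto intro: continuous_on_subset[OF continuous_on_cheb_T] abs_cheb_T_le_1\<close>)
    ultimately show ?thesis
      using uv by (simp add: E_def)
  qed
  have sgrid: "(\<lambda>k. \<Sum>j\<le>n. w j * (?c k * cheb_T k (tau n j))) sums (\<Sum>j\<le>n. w j * f (tau n j))"
    by (intro sums_sum sums_mult cheb_expansion[OF cont summ] tau_in)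
  have sint: "(\<lambda>k. integral {u..v} (\<lambda>s. ?c k * cheb_T k s)) sums integral {u..v} f"
  proof -
    have "\<bar>?c k * cheb_T k s\<bar> \<le> \<bar>?c k\<bar>" for k s
      using mult_left_mono[OF abs_cheb_T_le_1, of "\<bar>?c k\<bar>"] by (simp add: abs_mult)
    then have "(\<lambda>k. integral {u..v} (\<lambda>s. ?c k * cheb_T k s)) sums integral {u..v} (\<lambda>s. \<Sum>k. ?c k * cheb_T k s)"
      by (intro sums_integral_suminf[OF _ _ summ] continuous_on_mult_left
          continuous_on_subset[OF continuous_on_cheb_T]) (use uv in auto)
    also have "integral {u..v} (\<lambda>s. \<Sum>k. ?c k * cheb_T k s) = integral {u..v} f"
      by (intro integral_cong sums_unique[symmetric] cheb_expansion[OF cont summ]) (use uv in auto)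
    finally show ?thesis .
  qed
  have "(\<Sum>j\<le>n. w j * (?c k * cheb_T k (tau n j))) - integral {u..v} (\<lambda>s. ?c k * cheb_T k s) = ?c k * E k" for k
    by (simp add: E_def right_diff_distrib sum_distrib_left mult_ac)
  then have "(\<lambda>k. ?c k * E k) sums ((\<Sum>j\<le>n. w j * f (tau n j)) - integral {u..v} f)"
    using sums_diff[OF sgrid sint] by simp
  \<comment> \<open>The first n terms vanish by \<open>E0\<close>, so the error is a series over the
    tail of the coefficients.\<close>
  from sums_split_initial_segment[OF this, of n]
  have "(\<lambda>k. ?c (k + n) * E (k + n)) sums ((\<Sum>j\<le>n. w j * f (tau n j)) - integral {u..v} f)"
    by (simp add: E0)
  then have eq: "(\<Sum>j\<le>n. w j * f (tau n j)) - integral {u..v} f = (\<Sum>k. ?c (k + n) * E (k + n))"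
    by (simp add: sums_iff)
  have summ': "summable (\<lambda>k. 5 * \<bar>?c (k + n)\<bar>)"
    by (intro summable_mult summable_ignore_initial_segment summ)
  have "norm (\<Sum>k. ?c (k + n) * E (k + n)) \<le> (\<Sum>k. 5 * \<bar>?c (k + n)\<bar>)"
    using mult_right_mono[OF E5 abs_ge_zero]
    by (intro norm_suminf_le[OF _ summ']) (simp add: abs_mult mult.commute[of "\<bar>cheb_coeff f _\<bar>"])
  also have "\<dots> = 5 * (\<Sum>k. \<bar>?c (k + n)\<bar>)"
    by (intro suminf_mult summable_ignore_initial_segment summ)
  finally show ?thesis
    by (simp add: eq)
qed

section \<open>Discrete orthogonality and the inverse of the Chebyshev matrix\<close>

lemma sum_cos_theta:
  assumes "0 < m" "m < 2 * (n + 1)"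
  shows "(\<Sum>k\<le>n. cos (real m * theta n k)) = 0"
proof -
  \<comment> \<open>\<open>\<phi>\<close> is chosen so that m theta_k = (2k + 1)
    \<open>\<phi>\<close>. Multiplying the sum by 2 sin \<open>\<phi>\<close> makes it telescope to
    sin(m pi) = 0, and the range of m keeps sin \<open>\<phi>\<close> nonzero.\<close>
  define \<phi> where "\<phi> = real m * pi / (2 * (real n + 1))"
  have "\<phi> > 0"
    using assms by (simp add: \<phi>_def)
  have "real m < real (2 * (n + 1))"
    using assms by (simp only: of_nat_less_iff)
  then have "real m * pi < (2 * (real n + 1)) * pi"
    by (intro mult_strict_right_mono) auto
  then have "\<phi> < pi"
    by (simp add: \<phi>_def pos_divide_less_eq mult.commute)
  then have "sin \<phi> \<noteq> 0"
    using sin_gt_zero[OF \<open>\<phi> > 0\<close>] by simp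
  have "2 * sin \<phi> * cos (real m * theta n k) = sin (2 * real (Suc k) * \<phi>) - sin (2 * real k * \<phi>)" for k
  proof -
    have "real m * theta n k = 2 * real k * \<phi> + \<phi>" "2 * real (Suc k) * \<phi> = 2 * real k * \<phi> + \<phi> + \<phi>"
      by (simp_all add: theta_def \<phi>_def add_divide_distrib distrib_left distrib_right mult_ac)
    moreover have "sin (2 * real k * \<phi>) = sin (2 * real k * \<phi> + \<phi> - \<phi>)"
      by simp
    ultimately show ?thesis
      by (simp only: sin_add[of "2 * real k * \<phi> + \<phi>" \<phi>] sin_diff[of "2 * real k * \<phi> + \<phi>" \<phi>]) simp
  qed
  then have "2 * sin \<phi> * (\<Sum>k\<le>n. cos (real m * theta n k)) = (\<Sum>k<Suc n. sin (2 * real (Suc k) * \<phi>) - sin (2 * real k * \<phi>))"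
    by (simp only: sum_distrib_left lessThan_Suc_atMost)
  also have "\<dots> = sin (2 * real (Suc n) * \<phi>)"
    using sum_lessThan_telescope[of "\<lambda>k. sin (2 * real k * \<phi>)" "Suc n"] by simp
  also have "2 * real (Suc n) * \<phi> = real m * pi"
    by (simp add: \<phi>_def field_simps)
  finally show ?thesis
    using \<open>sin \<phi> \<noteq> 0\<close> by simp
qed

lemma sum_cos_theta_cos_theta:
  assumes "i \<le> n" "j \<le> n"
  shows "(\<Sum>k\<le>n. cos (real i * theta n k) * cos (real j * theta n k)) =
    (if i \<noteq> j then 0 else if i = 0 then real n + 1 else (real n + 1) / 2)"
proof -
  have "(\<Sum>k\<le>n. cos (real i * theta n k) * cos (real j * theta n k)) =
     ((\<Sum>k\<le>n. cos (real (if i \<le> j then j - i else i - j) * theta n k)) + (\<Sum>k\<le>n. cos (real (i + j) * theta n k))) / 2"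
    by (simp only: cos_prod_nat sum.distrib flip: sum_divide_distrib)
  moreover have sum: "(\<Sum>k\<le>n. cos (real m * theta n k)) = (if m = 0 then real n + 1 else 0)" if "m < 2 * (n + 1)" for m
    using sum_cos_theta[of m n] that by simp
  have "i + j < 2 * (n + 1)" "(if i \<le> j then j - i else i - j) < 2 * (n + 1)"
    using assms by auto
  note this[THEN sum]
  ultimately show ?thesis
    by (simp only:) auto
qed

text \<open>Discrete orthogonality supplies an explicit left inverse \<open>D\<close>, the transpose
  of \<open>C_mat\<close> with rescaled rows. A left inverse of a square matrix is two-sided, so
  \<open>mat_inverse\<close> returns a value and \<open>the\<close> is harmless.\<close>

lemma C_inv:
  shows C_inv_carrier: "C_inv n \<in> carrier_mat (n + 1) (n + 1)"
    and C_inv_C: "C_inv n * C_mat n = 1\<^sub>m (n + 1)"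
proof -
  let ?N = "n + 1"
  define D where "D = mat ?N ?N (\<lambda>(j, k). (if j = 0 then 1 else 2) / (real n + 1) * cheb_T j (tau n k))"
  have D: "D \<in> carrier_mat ?N ?N" and C: "C_mat n \<in> carrier_mat ?N ?N"
    by (simp_all add: D_def C_mat_def)
  have DC: "D * C_mat n = 1\<^sub>m ?N"
  proof (rule eq_matI)
    fix i j
    assume "i < dim_row (1\<^sub>m ?N :: real mat)" "j < dim_col (1\<^sub>m ?N :: real mat)"
    then have ij: "i \<le> n" "j \<le> n"
      by auto
    then have "(D * C_mat n) $$ (i, j) =
       (\<Sum>k\<in>{0..<?N}. (if i = 0 then 1 else 2) / (real n + 1) * cheb_T i (tau n k) * cheb_T j (tau n k))"
      by (simp add: D_def C_mat_def scalar_prod_def)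
    also have "{0..<?N} = {..n}"
      by auto
    also have "(\<Sum>k\<le>n. (if i = 0 then 1 else 2) / (real n + 1) * cheb_T i (tau n k) * cheb_T j (tau n k)) =
       (if i = 0 then 1 else 2) / (real n + 1) * (\<Sum>k\<le>n. cos (real i * theta n k) * cos (real j * theta n k))"
      unfolding sum_distrib_left by (intro sum.cong) (auto simp: cheb_T_tau)
    also have "\<dots> = 1\<^sub>m ?N $$ (i, j)"
      unfolding sum_cos_theta_cos_theta[OF ij] using ij by (auto simp: field_simps)
    finally show "(D * C_mat n) $$ (i, j) = 1\<^sub>m ?N $$ (i, j)" .
  qed (use D C in auto)
  then have "C_mat n * D = 1\<^sub>m ?N"
    using mat_mult_left_right_inverse[OF D C] by blast
  then have "C_mat n \<in> Units (ring_mat TYPE(real) ?N ())"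
    using DC D C by (auto simp: Units_def ring_mat_def)
  then obtain B where B: "mat_inverse (C_mat n) = Some B"
    using mat_inverse(1)[OF C] by fastforce
  then show "C_inv n \<in> carrier_mat ?N ?N" "C_inv n * C_mat n = 1\<^sub>m ?N"
    using mat_inverse(2)[OF C B] by (auto simp: C_inv_def)
qed

section \<open>Action of the integration matrices on samples of T_m\<close>

lemma index_mult_mat_sum:
  fixes X Y :: "real mat"
  assumes "X \<in> carrier_mat (n + 1) (n + 1)" "Y \<in> carrier_mat (n + 1) (n + 1)" "i \<le> n" "j \<le> n"
  shows "(X * Y) $$ (i, j) = (\<Sum>k\<le>n. X $$ (i, k) * Y $$ (k, j))"
  using assms by (auto simp: scalar_prod_def atLeast0LessThan lessThan_Suc_atMost)

text \<open>The samples of T_m are column m of \<open>C_mat\<close>, which \<open>C_inv\<close>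
  cancels, leaving entry (i, m) of C P B. Since row 0 of B is zero, only the columns l >= 1 of P
  matter. This is the common core for the left and right matrices.\<close>

lemma conj_spectral_mat_cheb_T:
  assumes P: "P \<in> carrier_mat (n + 1) (n + 1)" and im: "i \<le> n" "m \<le> n"
    and CP: "\<And>l. 1 \<le> l \<Longrightarrow> l \<le> n \<Longrightarrow> (\<Sum>k\<le>n. cheb_T k (tau n i) * P $$ (k, l)) = d l"
  shows "(\<Sum>j\<le>n. (C_mat n * (P * B_mat n) * C_inv n) $$ (i, j) * cheb_T m (tau n j)) =
    (\<Sum>l=1..n. B_mat n $$ (l, m) * d l)"
proof -
  have C: "C_mat n \<in> carrier_mat (n + 1) (n + 1)" and B: "B_mat n \<in> carrier_mat (n + 1) (n + 1)"
    by (simp_all add: C_mat_def B_mat_def)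
  define W where "W = C_mat n * (P * B_mat n) * C_inv n"
  have W: "W \<in> carrier_mat (n + 1) (n + 1)"
    unfolding W_def by (rule mult_carrier_mat mult_carrier_mat[OF C mult_carrier_mat[OF P B]] C_inv_carrier)+
  have "(\<Sum>j\<le>n. W $$ (i, j) * cheb_T m (tau n j)) = (W * C_mat n) $$ (i, m)"
    unfolding index_mult_mat_sum[OF W C im] using im by (simp add: C_mat_def)
  also have "W * C_mat n = C_mat n * P * B_mat n"
    unfolding W_def using C B P C_inv_carrier[of n] C_inv_C[of n]
    by (simp add: assoc_mult_mat[of _ "n + 1" "n + 1" _ "n + 1" _ "n + 1"])
  also have "(C_mat n * P * B_mat n) $$ (i, m) = (\<Sum>l\<le>n. (C_mat n * P) $$ (i, l) * B_mat n $$ (l, m))"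
    by (rule index_mult_mat_sum[OF mult_carrier_mat[OF C P] B im])
  also have "\<dots> = (\<Sum>l=1..n. B_mat n $$ (l, m) * d l)"
  proof (rule sum.mono_neutral_cong_right)
    fix l
    assume "l \<in> {1..n}"
    then have l: "1 \<le> l" "l \<le> n"
      by auto
    have "(C_mat n * P) $$ (i, l) = d l"
      unfolding index_mult_mat_sum[OF C P im(1) l(2)] CP[OF l, symmetric] using im by (simp add: C_mat_def)
    then show "(C_mat n * P) $$ (i, l) * B_mat n $$ (l, m) = B_mat n $$ (l, m) * d l"
      by simp
  next
    show "\<forall>l\<in>{..n} - {1..n}. (C_mat n * P) $$ (i, l) * B_mat n $$ (l, m) = 0"
      using im by (auto simp: B_mat_def)
  qed auto
  finally show ?thesis
    by (simp add: W_def)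
qed

lemma cheb_T_0 [simp]: "cheb_T 0 s = 1"
  by (simp add: cheb_T_def)

lemma cheb_T_1 [simp]: "cheb_T l 1 = 1"
  by (simp add: cheb_T_def)

lemma cheb_T_minus_1: "cheb_T l (-1) = (-1) ^ l"
  by (simp add: cheb_T_def mult.commute)

text \<open>Row 0 of \<open>PL_mat\<close> contributes (-1)^(l+1) = -T_l(-1), the integration
  constant that makes the antiderivative vanish at -1.\<close>

lemma W_mat_cheb_T:
  assumes "i \<le> n" "m \<le> n"
  shows "(\<Sum>j\<le>n. W_mat n $$ (i, j) * cheb_T m (tau n j)) =
    (\<Sum>l=1..n. B_mat n $$ (l, m) * (cheb_T l (tau n i) - cheb_T l (-1)))"
  unfolding W_mat_def SL_mat_def
proof (rule conj_spectral_mat_cheb_T[OF _ assms])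
  fix l
  assume l: "1 \<le> l" "l \<le> n"
  have "(\<Sum>k\<le>n. cheb_T k (tau n i) * PL_mat n $$ (k, l)) =
    (\<Sum>k\<le>n. (if k = 0 then (-1) ^ (l + 1) else 0) + (if k = l then cheb_T l (tau n i) else 0))"
    using l by (intro sum.cong) (auto simp: PL_mat_def)
  also have "\<dots> = cheb_T l (tau n i) - cheb_T l (-1)"
    using l by (simp add: sum.distrib cheb_T_minus_1)
  finally show "(\<Sum>k\<le>n. cheb_T k (tau n i) * PL_mat n $$ (k, l)) = cheb_T l (tau n i) - cheb_T l (-1)" .
qed (simp add: PL_mat_def)

text \<open>Here row 0 contributes T_l(1) = 1 and the negated identity -T_l, which corresponds to
  integration from the node up to 1.\<close>

lemma V_mat_cheb_T:
  assumes "i \<le> n" "m \<le> n"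
  shows "(\<Sum>j\<le>n. V_mat n $$ (i, j) * cheb_T m (tau n j)) =
    (\<Sum>l=1..n. B_mat n $$ (l, m) * (cheb_T l 1 - cheb_T l (tau n i)))"
  unfolding V_mat_def SR_mat_def
proof (rule conj_spectral_mat_cheb_T[OF _ assms])
  fix l
  assume l: "1 \<le> l" "l \<le> n"
  have "(\<Sum>k\<le>n. cheb_T k (tau n i) * PR_mat n $$ (k, l)) =
    (\<Sum>k\<le>n. (if k = 0 then 1 else 0) + (if k = l then - cheb_T l (tau n i) else 0))"
    using l by (intro sum.cong) (auto simp: PR_mat_def)
  also have "\<dots> = cheb_T l 1 - cheb_T l (tau n i)"
    using l by (simp add: sum.distrib)
  finally show "(\<Sum>k\<le>n. cheb_T k (tau n i) * PR_mat n $$ (k, l)) = cheb_T l 1 - cheb_T l (tau n i)" .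
qed (simp add: PR_mat_def)

text \<open>The constant is fixed before t, n, the limits u, v and the weights w. It therefore
  serves all rows of \<open>W_mat\<close> (u = -1) and of \<open>V_mat\<close> (v = 1)
  alike.\<close>

lemma unif_Ck_spectral_quadrature_error:
  fixes F :: "'t \<Rightarrow> real \<Rightarrow> real"
  assumes F: "unif_Ck r T {-1..1} F" and r: "r \<ge> 2"
  obtains C where "\<And>t n u v w. t \<in> T \<Longrightarrow> n \<ge> 1 \<Longrightarrow> -1 \<le> u \<Longrightarrow> u \<le> v \<Longrightarrow> v \<le> 1 \<Longrightarrow>
    (\<And>m. m \<le> n \<Longrightarrow> (\<Sum>j\<le>n. w j * cheb_T m (tau n j)) =
      (\<Sum>l=1..n. B_mat n $$ (l, m) * (cheb_T l v - cheb_T l u))) \<Longrightarrow>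
    \<bar>(\<Sum>j\<le>n. w j * F t (tau n j)) - integral {u..v} (F t)\<bar> \<le> C / real n ^ (r - 1)"
proof -
  obtain C where C: "\<And>t k. t \<in> T \<Longrightarrow> \<bar>cosine_coeff (F t) k\<bar> \<le> C / (real k + 1) ^ r"
    using unif_Ck_cosine_coeff_decay[OF F] by blast
  have cheb: "\<bar>cheb_coeff (F t) k\<bar> \<le> C / (real k + 1) ^ r" if "t \<in> T" for t k
  proof -
    have "\<bar>cheb_coeff (F t) k\<bar> \<le> 1 * \<bar>cosine_coeff (F t) k\<bar>"
      \<comment> \<open>Both normalising factors 1/pi and 2/pi are at most 1.\<close>
      unfolding cheb_coeff_def abs_mult using pi_gt3 by (intro mult_right_mono) auto
    then show ?thesis
      using C[OF that, of k] by simp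
  qed
  show thesis
  proof (rule that[of "5 * C"])
    fix t n u v and w :: "nat \<Rightarrow> real"
    assume t: "t \<in> T" and n: "n \<ge> 1" and uv: "-1 \<le> u" "u \<le> v" "v \<le> 1"
      and w: "\<And>m. m \<le> n \<Longrightarrow> (\<Sum>j\<le>n. w j * cheb_T m (tau n j)) =
        (\<Sum>l=1..n. B_mat n $$ (l, m) * (cheb_T l v - cheb_T l u))"
    have "C \<ge> 0"
      using C[OF t, of 0] by (simp add: order_trans[OF abs_ge_zero])
    have summ: "summable (\<lambda>k. \<bar>cheb_coeff (F t) k\<bar>)"
      by (rule summable_comparison_test'[OF summable_inverse_power[OF r, of C], of 0]) (simp add: cheb[OF t])
    have "continuous_on {-1..1} (F t)"
      using unif_Ck_imp_unif_C0[OF F] t by (auto simp: unif_C0_def)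
    then have "\<bar>(\<Sum>j\<le>n. w j * F t (tau n j)) - integral {u..v} (F t)\<bar> \<le> 5 * (\<Sum>k. \<bar>cheb_coeff (F t) (k + n)\<bar>)"
      by (intro spectral_quadrature_error n uv w summ)
    also have "(\<Sum>k. \<bar>cheb_coeff (F t) (k + n)\<bar>) \<le> (\<Sum>k. C / (real (k + n) + 1) ^ r)"
      by (intro suminf_le cheb t summable_ignore_initial_segment[OF summ]
          summable_ignore_initial_segment[OF summable_inverse_power[OF r]])
    also have "\<dots> \<le> C / real n ^ (r - 1)"
      by (rule suminf_inverse_power_tail_le[OF r n \<open>C \<ge> 0\<close>])
    finally show "\<bar>(\<Sum>j\<le>n. w j * F t (tau n j)) - integral {u..v} (F t)\<bar> \<le> 5 * C / real n ^ (r - 1)"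
      by simp
  qed
qed

section \<open>The residual of the discretized equation\<close>

lemma integral_affine_subst:
  fixes f :: "real \<Rightarrow> real"
  assumes "h > 0" and "continuous_on {u..v} (\<lambda>s. f (h * s + c))"
  shows "integral {h * u + c..h * v + c} f = h * integral {u..v} (\<lambda>s. f (h * s + c))"
proof -
  have "((\<lambda>s. f (h * s + c)) has_integral integral {u..v} (\<lambda>s. f (h * s + c))) {u..v}"
    using integrable_continuous_real[OF assms(2)] by (rule integrable_integral)
  then have "(f has_integral h * integral {u..v} (\<lambda>s. f (h * s + c))) (cbox (h * u + c) (h * v + c))"
    using assms(1) has_integral_affinity_iff[OF assms(1), of f c "h * integral {u..v} (\<lambda>s. f (h * s + c))" "h * u + c" "h * v + c"]
    by (simp flip: mult.assoc)
  then show ?thesis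
    by (simp add: integral_unique)
qed

lemma abs_max_norm_le:
  assumes "dim_vec v > 0" and "\<And>i. i < dim_vec v \<Longrightarrow> \<bar>v $ i\<bar> \<le> B"
  shows "\<bar>max_norm v\<bar> \<le> B"
proof -
  have "max_norm v \<in> (\<lambda>i. \<bar>v $ i\<bar>) ` {..<dim_vec v}"
    unfolding max_norm_def using assms(1) by (intro Max_in) auto
  then show ?thesis
    using assms(2) by auto
qed

lemma W_mat_carrier: "W_mat n \<in> carrier_mat (n + 1) (n + 1)"
  and V_mat_carrier: "V_mat n \<in> carrier_mat (n + 1) (n + 1)"
  unfolding W_mat_def V_mat_def SL_mat_def SR_mat_def using C_inv_carrier[of n]
  by (auto simp: C_mat_def)

lemma sys_mat_carrier: "sys_mat a b k1 k2 n \<in> carrier_mat (n + 1) (n + 1)"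
  using W_mat_carrier[of n] V_mat_carrier[of n] by (auto simp: sys_mat_def schur_prod_def)

text \<open>The Schur product moves the kernel into the sum: row i of \<open>W_mat\<close> or
  \<open>V_mat\<close> acts on the samples of the full integrand with t frozen at the i-th
  node.\<close>

lemma sys_mat_mult_sample_vec:
  assumes "i \<le> n"
  shows "(sys_mat a b k1 k2 n *\<^sub>v sample_vec a b x n) $ i = x (eta a b n i) + (b - a) / 2 *
    ((\<Sum>j\<le>n. W_mat n $$ (i, j) * (k1 (eta a b n i) (eta a b n j) * x (eta a b n j))) +
     (\<Sum>j\<le>n. V_mat n $$ (i, j) * (k2 (eta a b n i) (eta a b n j) * x (eta a b n j))))"
proof -
  let ?e = "eta a b n"
  have "(sys_mat a b k1 k2 n *\<^sub>v sample_vec a b x n) $ i =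
    (\<Sum>j\<le>n. sys_mat a b k1 k2 n $$ (i, j) * x (?e j))"
    using sys_mat_carrier[of a b k1 k2 n] assms
    by (auto simp: scalar_prod_def sample_vec_def atLeast0LessThan lessThan_Suc_atMost)
  also have "\<dots> = (\<Sum>j\<le>n. (if i = j then x (?e i) else 0) + (b - a) / 2 *
     (W_mat n $$ (i, j) * (k1 (?e i) (?e j) * x (?e j)) + V_mat n $$ (i, j) * (k2 (?e i) (?e j) * x (?e j))))"
    using assms W_mat_carrier[of n] V_mat_carrier[of n]
    by (intro sum.cong) (auto simp: sys_mat_def schur_prod_def K_mat_def algebra_simps)
  finally show ?thesis
    unfolding sum.distrib sum_distrib_left[symmetric] using assms by simp
qed

lemma eta_in: "a < b \<Longrightarrow> eta a b n i \<in> {a..b}"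
proof -
  assume "a < b"
  then have "(b - a) / 2 * (-1) \<le> (b - a) / 2 * tau n i" "(b - a) / 2 * tau n i \<le> (b - a) / 2 * 1"
    using tau_in[of n i] by (intro mult_left_mono; simp)+
  then show ?thesis
    by (auto simp: eta_def field_simps)
qed

text \<open>For fixed t the kernel is restricted to the line through (t, c) with direction (0, h),
  which stays in the square for s in [-1, 1].\<close>

lemma unif_Ck_kernel_mult:
  fixes \<kappa> :: "real \<Rightarrow> real \<Rightarrow> real"
  assumes "a < b" and \<kappa>: "Ck_on p ({a..b} \<times> {a..b}) (\<lambda>(t, s). \<kappa> t s)" and x: "Ck_on r {a..b} x"
    and "r \<le> p"
  defines "h \<equiv> (b - a) / 2" and "c \<equiv> (a + b) / 2"
  shows "unif_Ck r {a..b} {-1..1} (\<lambda>t s. \<kappa> t (h * s + c) * x (h * s + c))"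
proof (rule unif_Ck_mult)
  have in_ab: "h * s + c \<in> {a..b}" if "s \<in> {-1..1}" for s
  proof -
    have "h * (-1) \<le> h * s" "h * s \<le> h * 1"
      using that \<open>a < b\<close> by (intro mult_left_mono; simp add: h_def)+
    then show ?thesis
      by (auto simp: h_def c_def field_simps)
  qed
  have "unif_Ck p {a..b} {-1..1} (\<lambda>t s. (\<lambda>(t, s). \<kappa> t s) ((t, c) + s *\<^sub>R (0, h)))"
    using in_ab by (intro Ck_on_imp_unif_Ck_line[OF \<kappa>] compact_Times) (auto simp: add.commute mult.commute)
  then show "unif_Ck r {a..b} {-1..1} (\<lambda>t s. \<kappa> t (h * s + c))"
    using \<open>r \<le> p\<close> by (auto intro: unif_Ck_mono simp: add.commute mult.commute)
  have "unif_Ck r {a..b} {-1..1} (\<lambda>t s. x (c + s *\<^sub>R h))"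
    using in_ab by (intro Ck_on_imp_unif_Ck_line[OF x]) (auto simp: add.commute mult.commute)
  then show "unif_Ck r {a..b} {-1..1} (\<lambda>t s. x (h * s + c))"
    by (simp add: add.commute mult.commute)
qed

theorem theorem1:
  fixes a b :: real and p1 p2 q r :: nat
    and k k1 k2 :: "real \<Rightarrow> real \<Rightarrow> real" and x y :: "real \<Rightarrow> real"
    and xbar :: "nat \<Rightarrow> real vec"
  assumes "a < b"
    and "r = Min {p1, p2, q}" and "r > 1"
    and "semismooth a b p1 p2 k k1 k2"
    and "Ck_on q {a..b} y"
    and "int_op_invertible r a b k1 k2"
    and "Ck_on r {a..b} x"
    and "\<forall>t\<in>{a..b}. int_op a b k1 k2 x t = y t"
    and "\<forall>\<^sub>F n in sequentially. xbar n \<in> carrier_vec (n + 1) \<and>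
           sys_mat a b k1 k2 n *\<^sub>v xbar n = sample_vec a b y n"
  shows "(\<lambda>n. max_norm (sys_mat a b k1 k2 n *\<^sub>v (sample_vec a b x n - xbar n)))
           \<in> O(\<lambda>n. 1 / real n ^ (r - 1))"
proof -
  define h where "h = (b - a) / 2"
  define c where "c = (a + b) / 2"
  have "h > 0"
    using \<open>a < b\<close> by (simp add: h_def)
  define F where "F \<kappa> t s = \<kappa> t (h * s + c) * x (h * s + c)" for \<kappa> :: "real \<Rightarrow> real \<Rightarrow> real" and t s
  have eta: "eta a b n i = h * tau n i + c" for n i
    by (simp add: eta_def h_def c_def)
  \<comment> \<open>The end points are written as images of -1 and 1 so that the substitution
    formula matches the limits of both integrals.\<close>
  have ab: "a = h * (-1) + c" "b = h * 1 + c"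
    by (simp_all add: h_def c_def field_simps)
  have "r \<le> p1" "r \<le> p2" "r \<ge> 2"
    using assms(2,3) by auto
  have F1: "unif_Ck r {a..b} {-1..1} (F k1)" and F2: "unif_Ck r {a..b} {-1..1} (F k2)"
    unfolding F_def[abs_def] h_def c_def
    by (rule unif_Ck_kernel_mult[OF \<open>a < b\<close> _ assms(7)]; use assms(4) \<open>r \<le> p1\<close> \<open>r \<le> p2\<close> in \<open>simp add: semismooth_def\<close>)+
  obtain C1 where C1: "\<And>t n u v w. t \<in> {a..b} \<Longrightarrow> n \<ge> 1 \<Longrightarrow> -1 \<le> u \<Longrightarrow> u \<le> v \<Longrightarrow> v \<le> 1 \<Longrightarrow>
    (\<And>m. m \<le> n \<Longrightarrow> (\<Sum>j\<le>n. w j * cheb_T m (tau n j)) =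
      (\<Sum>l=1..n. B_mat n $$ (l, m) * (cheb_T l v - cheb_T l u))) \<Longrightarrow>
    \<bar>(\<Sum>j\<le>n. w j * F k1 t (tau n j)) - integral {u..v} (F k1 t)\<bar> \<le> C1 / real n ^ (r - 1)"
    using unif_Ck_spectral_quadrature_error[OF F1 \<open>r \<ge> 2\<close>] by blast
  obtain C2 where C2: "\<And>t n u v w. t \<in> {a..b} \<Longrightarrow> n \<ge> 1 \<Longrightarrow> -1 \<le> u \<Longrightarrow> u \<le> v \<Longrightarrow> v \<le> 1 \<Longrightarrow>
    (\<And>m. m \<le> n \<Longrightarrow> (\<Sum>j\<le>n. w j * cheb_T m (tau n j)) =
      (\<Sum>l=1..n. B_mat n $$ (l, m) * (cheb_T l v - cheb_T l u))) \<Longrightarrow>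
    \<bar>(\<Sum>j\<le>n. w j * F k2 t (tau n j)) - integral {u..v} (F k2 t)\<bar> \<le> C2 / real n ^ (r - 1)"
    using unif_Ck_spectral_quadrature_error[OF F2 \<open>r \<ge> 2\<close>] by blast
  have subst: "integral {h * u + c..h * v + c} (\<lambda>s. \<kappa> t s * x s) = h * integral {u..v} (F \<kappa> t)"
    if "unif_Ck r {a..b} {-1..1} (F \<kappa>)" "t \<in> {a..b}" "-1 \<le> u" "v \<le> 1" for \<kappa> t u v
  proof -
    have "continuous_on {-1..1} (F \<kappa> t)"
      using unif_Ck_imp_unif_C0[OF that(1)] that(2) by (auto simp: unif_C0_def)
    then have "continuous_on {u..v} (F \<kappa> t)"
      by (rule continuous_on_subset) (use that in auto)
    then show ?thesis
      using integral_affine_subst[OF \<open>h > 0\<close>, of u v "\<lambda>s. \<kappa> t s * x s" c] by (simp add: F_def[abs_def])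
  qed
  have residual: "\<bar>(sys_mat a b k1 k2 n *\<^sub>v (sample_vec a b x n - xbar n)) $ i\<bar> \<le> h * (C1 + C2) / real n ^ (r - 1)"
    if n: "n \<ge> 1" and i: "i \<le> n" and xbar: "xbar n \<in> carrier_vec (n + 1)"
      "sys_mat a b k1 k2 n *\<^sub>v xbar n = sample_vec a b y n" for n i
  proof -
    let ?t = "eta a b n i"
    have t: "?t \<in> {a..b}"
      by (rule eta_in[OF \<open>a < b\<close>])
    have tau: "-1 \<le> tau n i" "tau n i \<le> 1"
      using tau_in[of n i] by auto
    define e1 where "e1 = (\<Sum>j\<le>n. W_mat n $$ (i, j) * F k1 ?t (tau n j)) - integral {-1..tau n i} (F k1 ?t)"
    define e2 where "e2 = (\<Sum>j\<le>n. V_mat n $$ (i, j) * F k2 ?t (tau n j)) - integral {tau n i..1} (F k2 ?t)"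
    have e1: "\<bar>e1\<bar> \<le> C1 / real n ^ (r - 1)"
      unfolding e1_def using tau by (intro C1 t n W_mat_cheb_T i) auto
    have e2: "\<bar>e2\<bar> \<le> C2 / real n ^ (r - 1)"
      unfolding e2_def using tau by (intro C2 t n V_mat_cheb_T i) auto
    have int1: "integral {a..?t} (\<lambda>s. k1 ?t s * x s) = h * integral {-1..tau n i} (F k1 ?t)"
      using subst[OF F1 t, of "-1" "tau n i"] tau unfolding ab(1)[symmetric] eta[symmetric] by simp
    have int2: "integral {?t..b} (\<lambda>s. k2 ?t s * x s) = h * integral {tau n i..1} (F k2 ?t)"
      using subst[OF F2 t, of "tau n i" 1] tau unfolding ab(2)[symmetric] eta[symmetric] by simp
    \<comment> \<open>By linearity \<open>xbar\<close> is traded for the samples of y, which equal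
      those of \<open>int_op\<close> applied to x. The terms x(t) then cancel and only the two
      quadrature errors remain.\<close>
    have "sys_mat a b k1 k2 n *\<^sub>v (sample_vec a b x n - xbar n) =
        sys_mat a b k1 k2 n *\<^sub>v sample_vec a b x n - sample_vec a b y n"
      using mult_minus_distrib_mat_vec[OF sys_mat_carrier[of a b k1 k2 n] _ xbar(1), of "sample_vec a b x n"] xbar(2)
      by (simp add: sample_vec_def)
    then have "(sys_mat a b k1 k2 n *\<^sub>v (sample_vec a b x n - xbar n)) $ i =
        (sys_mat a b k1 k2 n *\<^sub>v sample_vec a b x n) $ i - y ?t"
      using i by (simp add: sample_vec_def)
    also have "\<dots> = (x ?t + h * ((\<Sum>j\<le>n. W_mat n $$ (i, j) * F k1 ?t (tau n j)) +
        (\<Sum>j\<le>n. V_mat n $$ (i, j) * F k2 ?t (tau n j)))) - int_op a b k1 k2 x ?t"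
      using assms(8) t unfolding sys_mat_mult_sample_vec[OF i] F_def h_def[symmetric] eta by simp
    \<comment> \<open>The factor (b - a)/2 of the matrix is also the Jacobian of the substitution,
      so it factors out of the whole difference.\<close>
    also have "\<dots> = h * (e1 + e2)"
      unfolding int_op_def int1 int2 e1_def e2_def by (simp add: algebra_simps)
    finally have "\<bar>(sys_mat a b k1 k2 n *\<^sub>v (sample_vec a b x n - xbar n)) $ i\<bar> = h * \<bar>e1 + e2\<bar>"
      using \<open>h > 0\<close> by (simp add: abs_mult)
    also have "\<dots> \<le> h * (C1 / real n ^ (r - 1) + C2 / real n ^ (r - 1))"
      using e1 e2 \<open>h > 0\<close> by (intro mult_left_mono) auto
    finally show ?thesis
      by (simp add: add_divide_distrib distrib_left)
  qed
  show ?thesis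
  proof (rule bigoI)
    show "\<forall>\<^sub>F n in sequentially.
        norm (max_norm (sys_mat a b k1 k2 n *\<^sub>v (sample_vec a b x n - xbar n)))
          \<le> h * (C1 + C2) * norm (1 / real n ^ (r - 1))"
      using assms(9) eventually_ge_at_top[of 1]
    proof eventually_elim
      case (elim n)
      have "dim_vec (sys_mat a b k1 k2 n *\<^sub>v (sample_vec a b x n - xbar n)) = n + 1"
        using sys_mat_carrier[of a b k1 k2 n] by auto
      then have "\<bar>max_norm (sys_mat a b k1 k2 n *\<^sub>v (sample_vec a b x n - xbar n))\<bar> \<le> h * (C1 + C2) / real n ^ (r - 1)"
        using elim by (intro abs_max_norm_le residual) auto
      then show ?case
        by simp
    qed
  qed
qed

end
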